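(* In the closed online TSP on the line under the LOCATIONS prediction model, the algorithm FARFIRST is $\min\left\{\frac{3(1+\eta)}{2},\,3\right\}$-competitive, where $\eta$ is the prediction error of the instance.
   Context: Online TSP on the line: an agent starts at the origin at time $0$ and moves on the real line with speed at most $1$. There is a set $Q=\{q_1,\dots,q_n\}$ of requests, each with a position (also denoted $q_i$) and a release time $rel(q_i)\ge 0$; the algorithm knows $n$ in advance, and learns a request (its position) only at its release time. A request $q$ is served at time $t$ if the agent was at position $q$ at some time $t'$ with $rel(q)\le t'\le t$. In the closed variant the makespan $|ALG|$ is the first time at which all requests are served and the agent is back at the origin. $|OPT|$ denotes the optimal offline makespan. An algorithm is $c$-competitive if $|ALG|\le c\,|OPT|$ on every instance. LOCATIONS prediction model: at time $0$ the algorithm receives predictions $P=\{p_1,\dots,p_n\}$, $p_i$ being a predicted position for $q_i$ (same labeling). By convention $Q$ contains a request at the origin released at time $0$ whose prediction is exactly $0$. Let $L=\min Q\le 0$, $R=\max Q\ge 0$ (positions), and the error is $\eta=\max_i|q_i-p_i|/(|L|+|R|)$. FARFIRST: let $farSide$ be the side (positive or negative) of the prediction furthest from the origin. The FARFIRST ordering of predictions lists the predictions on the far side in decreasing order of absolute value, then those on the other side in decreasing order of absolute value, then predictions at the origin; ties broken by label. Whenever a request is released (and at time $0$), FARFIRST recomputes a plan as follows and executes it at unit speed, waiting when the plan is exhausted. Let $pos$ be the current position, $O$ the set of released unserved requests, $p$ the first prediction in FARFIRST ordering whose request is not yet released ($p=0$ if none). Set $posSide=(pos>0)$, $pSide=(p>0)$;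 if $pos=0$ set $posSide=farSide$; if $p=0$ set $pSide$ to the opposite of $posSide$. For a side $s$ and finite set $S$, $ext(s,S)$ is $\max S$ if $s$ is the positive side and $\min S$ otherwise. The plan is: move to $ext(posSide,O\cup\{pos\})$, then move to $ext(pSide,O\cup\{p\})$, then move to $p$. *)

theory Defs
  imports "HOL-Analysis.Analysis"
begin

section \<open>Instances, trajectories and makespan\<close>

text \<open>Requests are labelled by the naturals below \<open>num\<close>. Request \<open>i\<close> has position \<open>loc i\<close>,
  release time \<open>rel i\<close> and predicted position \<open>prd i\<close>; values at labels \<open>\<ge> num\<close> are never used.\<close>

record line_instance =
  num :: nat
  loc :: "nat \<Rightarrow> real"
  rel :: "nat \<Rightarrow> real"
  prd :: "nat \<Rightarrow> real"

definition valid_instance :: "line_instance \<Rightarrow> bool" where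
  "valid_instance I \<longleftrightarrow>
     (\<forall>i<num I. 0 \<le> rel I i) \<and>
     (\<exists>i<num I. loc I i = 0 \<and> rel I i = 0 \<and> prd I i = 0)"

definition trajectory :: "(real \<Rightarrow> real) \<Rightarrow> bool" where
  "trajectory X \<longleftrightarrow> X 0 = 0 \<and> 1-lipschitz_on {0..} X"

definition served :: "line_instance \<Rightarrow> (real \<Rightarrow> real) \<Rightarrow> nat \<Rightarrow> real \<Rightarrow> bool" where
  "served I X i t \<longleftrightarrow> (\<exists>t'. rel I i \<le> t' \<and> t' \<le> t \<and> X t' = loc I i)"

definition complete :: "line_instance \<Rightarrow> (real \<Rightarrow> real) \<Rightarrow> real \<Rightarrow> bool" where
  "complete I X t \<longleftrightarrow> 0 \<le> t \<and> (\<forall>i<num I. served I X i t) \<and> X t = 0"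

text \<open>For a trajectory the set below is closed, so the infimum is the first completion time; it is
  \<open>\<infinity>\<close> if the trajectory never completes the tour.\<close>

definition makespan :: "line_instance \<Rightarrow> (real \<Rightarrow> real) \<Rightarrow> ereal" where
  "makespan I X = Inf (ereal ` {t. complete I X t})"

definition opt :: "line_instance \<Rightarrow> ereal" where
  "opt I = (INF X \<in> {X. trajectory X}. makespan I X)"

text \<open>The ratio may depend on the instance, through the prediction error.\<close>

definition competitive ::
    "(line_instance \<Rightarrow> real \<Rightarrow> real) \<Rightarrow> (line_instance \<Rightarrow> ereal) \<Rightarrow> bool" where
  "competitive A c \<longleftrightarrow>
     (\<forall>I. valid_instance I \<longrightarrow> trajectory (A I) \<and> makespan I (A I) \<le> c I * opt I)"

text \<open>The quotient is taken in the extended reals: if all requests lie at the origin, the error is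
  \<open>0\<close> when all predictions are exact (\<open>0 / 0 = 0\<close>) and \<open>\<infinity>\<close> otherwise.\<close>

definition pred_error :: "line_instance \<Rightarrow> ereal" where
  "pred_error I =
     ereal (Max ((\<lambda>i. \<bar>loc I i - prd I i\<bar>) ` {..<num I})) /
     ereal (\<bar>Min (loc I ` {..<num I})\<bar> + \<bar>Max (loc I ` {..<num I})\<bar>)"

section \<open>FARFIRST\<close>

text \<open>A side is a Boolean, \<open>True\<close> being the positive one. If predictions on both sides are furthest
  from the origin, or if all predictions are at the origin, both sides qualify as far side.\<close>

definition is_far_side :: "line_instance \<Rightarrow> bool \<Rightarrow> bool" where
  "is_far_side I s \<longleftrightarrow>
     (\<exists>i<num I. (\<forall>j<num I. \<bar>prd I j\<bar> \<le> \<bar>prd I i\<bar>) \<and> (prd I i \<noteq> 0 \<longrightarrow> s = (prd I i > 0)))"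

definition on_side :: "bool \<Rightarrow> real \<Rightarrow> bool" where
  "on_side s x \<longleftrightarrow> (if s then x > 0 else x < 0)"

text \<open>Sorting with \<^const>\<open>sort_key\<close> is stable, so ties are broken by label.\<close>

definition farfirst_order :: "bool \<Rightarrow> line_instance \<Rightarrow> nat list" where
  "farfirst_order s I =
     sort_key (\<lambda>i. - \<bar>prd I i\<bar>) (filter (\<lambda>i. on_side s (prd I i)) [0..<num I]) @
     sort_key (\<lambda>i. - \<bar>prd I i\<bar>) (filter (\<lambda>i. on_side (\<not> s) (prd I i)) [0..<num I]) @
     filter (\<lambda>i. prd I i = 0) [0..<num I]"

definition next_pred :: "bool \<Rightarrow> line_instance \<Rightarrow> real \<Rightarrow> real" where
  "next_pred s I t =
     (case find (\<lambda>i. t < rel I i) (farfirst_order s I) of None \<Rightarrow> 0 | Some i \<Rightarrow> prd I i)"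

definition ext :: "bool \<Rightarrow> real set \<Rightarrow> real" where
  "ext s S = (if s then Max S else Min S)"

text \<open>The list of successive destinations computed at time \<open>t\<close>, where \<open>X\<close> is the movement up to
  time \<open>t\<close> and \<open>s\<close> the far side.\<close>

definition plan :: "bool \<Rightarrow> line_instance \<Rightarrow> (real \<Rightarrow> real) \<Rightarrow> real \<Rightarrow> real list" where
  "plan s I X t =
    (let pos = X t;
         Os = loc I ` {i. i < num I \<and> rel I i \<le> t \<and> \<not> served I X i t};
         p = next_pred s I t;
         posSide = (if pos = 0 then s else pos > 0);
         pSide = (if p = 0 then \<not> posSide else p > 0)
     in [ext posSide (Os \<union> {pos}), ext pSide (Os \<union> {p}), p])"

text \<open>Position after time \<open>d\<close> when moving at unit speed from \<open>x\<close> through the given destinations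
  and then waiting.\<close>

fun follow :: "real \<Rightarrow> real list \<Rightarrow> real \<Rightarrow> real" where
  "follow x [] d = x"
| "follow x (w # ws) d =
     (if d \<le> \<bar>w - x\<bar> then x + sgn (w - x) * d else follow w ws (d - \<bar>w - x\<bar>))"

definition replan :: "bool \<Rightarrow> line_instance \<Rightarrow> (real \<Rightarrow> real) \<Rightarrow> real \<Rightarrow> (real \<Rightarrow> real)" where
  "replan s I X t0 = (\<lambda>t. if t \<le> t0 then X t else follow (X t0) (plan s I X t0) (t - t0))"

definition farfirst :: "bool \<Rightarrow> line_instance \<Rightarrow> real \<Rightarrow> real" where
  "farfirst s I =
     foldl (replan s I) (\<lambda>_. 0) (sorted_list_of_set (insert 0 (rel I ` {..<num I})))"

end

theory Submission
  imports Defs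
begin

text \<open>By reflection the far side may be taken to be positive. Let \<open>T\<close> be the completion time of any
  offline tour and \<open>e\<close> the largest deviation of a prediction. A request \<open>q\<close> released at time \<open>t\<close>
  forces \<open>t + \<bar>q\<bar> \<le> T\<close>, so when FARFIRST waits at a prediction on the far side it is back at the
  origin, with that side served, by time \<open>T + e\<close>; if it never waits there, by time \<open>2 * (R + e)\<close>.
  Since the far side of the predictions is the positive one, \<open>\<bar>L\<bar> \<le> R + 2 * e\<close>, whence
  \<open>2 * \<bar>L\<bar> \<le> T / 2 + 2 * e\<close>, and the excursion to the other side gives the bound
  \<open>3 / 2 * T + 3 * e\<close>. As \<open>T \<ge> 2 * (\<bar>L\<bar> + R)\<close>, the last term is at most \<open>3 / 2 * \<eta> * T\<close>.
  The bound \<open>3 * T\<close> only uses that at the last release, at a time at most \<open>T\<close>, the agent is within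
  distance \<open>T\<close> of the origin.\<close>

section \<open>Following a list of destinations\<close>

lemma follow_0 [simp]: "follow x ws 0 = x"
  by (induction ws arbitrary: x) auto

lemma follow_dist_start:
  assumes "0 \<le> d"
  shows "\<bar>follow x ws d - x\<bar> \<le> d"
  using assms
proof (induction ws arbitrary: x d)
  case (Cons w ws)
  show ?case
  proof (cases "d \<le> \<bar>w - x\<bar>")
    case True
    then show ?thesis using Cons.prems by (auto simp: sgn_if)
  next
    case False
    then have "\<bar>follow w ws (d - \<bar>w - x\<bar>) - w\<bar> \<le> d - \<bar>w - x\<bar>"
      using Cons.IH by simp
    then show ?thesis using False by auto
  qed
qed auto

lemma follow_dist_le:
  assumes "0 \<le> d" "d \<le> d'"
  shows "\<bar>follow x ws d' - follow x ws d\<bar> \<le> d' - d"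
  using assms
proof (induction ws arbitrary: x d d')
  case (Cons w ws)
  consider "d' \<le> \<bar>w - x\<bar>" | "d \<le> \<bar>w - x\<bar>" "\<bar>w - x\<bar> < d'" | "\<bar>w - x\<bar> < d"
    using Cons.prems by linarith
  then show ?case
  proof cases
    case 1
    then show ?thesis using Cons.prems by (auto simp: sgn_if)
  next
    case 2
    then have "\<bar>follow w ws (d' - \<bar>w - x\<bar>) - w\<bar> \<le> d' - \<bar>w - x\<bar>"
      by (intro follow_dist_start) auto
    then show ?thesis using 2 Cons.prems by (auto simp: sgn_if split: if_splits)
  next
    case 3
    then show ?thesis
      using Cons.IH[of "d - \<bar>w - x\<bar>" "d' - \<bar>w - x\<bar>" w] Cons.prems by auto
  qed
qed auto

lemma follow_lipschitz: "1-lipschitz_on {0..} (follow x ws)"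
proof (rule lipschitz_onI)
  fix d d' :: real assume "d \<in> {0..}" "d' \<in> {0..}"
  then show "dist (follow x ws d) (follow x ws d') \<le> 1 * dist d d'"
    using follow_dist_le[of d d' x ws] follow_dist_le[of d' d x ws]
    by (cases "d \<le> d'") (auto simp: dist_real_def)
qed simp

text \<open>Intermediate values: the image of a time interval under the continuous path is
  connected.\<close>

lemma follow_visits:
  assumes "d1 \<in> {0..d}" "d2 \<in> {0..d}" "follow x ws d1 \<le> z" "z \<le> follow x ws d2"
  shows "z \<in> follow x ws ` {0..d}"
proof -
  have "continuous_on {0..d} (follow x ws)"
    using lipschitz_on_continuous_on[OF follow_lipschitz] by (rule continuous_on_subset) auto
  then have "connected (follow x ws ` {0..d})"
    by (intro connected_continuous_image) auto
  then show ?thesis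
    using connected_contains_Icc[of "follow x ws ` {0..d}" "follow x ws d1" "follow x ws d2"] assms
    by auto
qed

text \<open>By continuity an unvisited point is never crossed, so it lies strictly to one side of
  the start, of the current position and of every turning point reached so far. The movement lemmas
  use this to locate the requests that are still unserved.\<close>

lemma not_visited_same_side:
  assumes "z \<notin> follow x [a, b, c] ` {0..d}" "0 \<le> d"
  defines "y \<equiv> follow x [a, b, c] d"
  shows "z < x \<and> z < y \<or> x < z \<and> y < z"
    and "\<bar>a - x\<bar> \<le> d \<Longrightarrow> z < x \<and> z < a \<and> z < y \<or> x < z \<and> a < z \<and> y < z"
    and "\<bar>a - x\<bar> + \<bar>b - a\<bar> \<le> d \<Longrightarrow>
      z < x \<and> z < a \<and> z < b \<and> z < y \<or> x < z \<and> a < z \<and> b < z \<and> y < z"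
proof -
  let ?f = "follow x [a, b, c]"
  have same: "z < x \<and> z < ?f d1 \<or> x < z \<and> ?f d1 < z" if "d1 \<in> {0..d}" for d1
  proof -
    have "\<not> (x \<le> z \<and> z \<le> ?f d1)" "\<not> (?f d1 \<le> z \<and> z \<le> x)"
      using follow_visits[of 0 d d1 x "[a, b, c]" z] follow_visits[of d1 d 0 x "[a, b, c]" z]
        that assms(1,2) unfolding follow_0 by (auto simp del: follow.simps)
    then show ?thesis by linarith
  qed
  have fa: "?f \<bar>a - x\<bar> = a" by (auto simp: sgn_if)
  have fb: "?f (\<bar>a - x\<bar> + \<bar>b - a\<bar>) = b" by (auto simp: sgn_if)
  have y: "z < x \<and> z < y \<or> x < z \<and> y < z"
    using same[of d] assms(2) unfolding y_def by (simp del: follow.simps)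
  have a: "z < x \<and> z < a \<or> x < z \<and> a < z" if "\<bar>a - x\<bar> \<le> d"
    using same[of "\<bar>a - x\<bar>"] that unfolding fa by (simp del: follow.simps)
  have b: "z < x \<and> z < b \<or> x < z \<and> b < z" if "\<bar>a - x\<bar> + \<bar>b - a\<bar> \<le> d"
    using same[of "\<bar>a - x\<bar> + \<bar>b - a\<bar>"] that unfolding fb by (simp del: follow.simps)
  show "z < x \<and> z < y \<or> x < z \<and> y < z" by (fact y)
  show "z < x \<and> z < a \<and> z < y \<or> x < z \<and> a < z \<and> y < z" if "\<bar>a - x\<bar> \<le> d"
    using y a that by linarith
  show "z < x \<and> z < a \<and> z < b \<and> z < y \<or> x < z \<and> a < z \<and> b < z \<and> y < z"
    if "\<bar>a - x\<bar> + \<bar>b - a\<bar> \<le> d"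
    using y a b that by linarith
qed

text \<open>Replaces \<open>sgn\<close> by linear formulas for each leg. The time ranges are closed
  and overlap at the turning times, which suits linear arithmetic.\<close>

lemma follow_legs:
  assumes "0 \<le> d"
  obtains (first) "d \<le> \<bar>a - x\<bar>"
      "x \<le> a \<longrightarrow> follow x [a, b, c] d = x + d" "a \<le> x \<longrightarrow> follow x [a, b, c] d = x - d"
  | (second) "\<bar>a - x\<bar> \<le> d" "d \<le> \<bar>a - x\<bar> + \<bar>b - a\<bar>"
      "a \<le> b \<longrightarrow> follow x [a, b, c] d = a + (d - \<bar>a - x\<bar>)"
      "b \<le> a \<longrightarrow> follow x [a, b, c] d = a - (d - \<bar>a - x\<bar>)"
  | (third) "\<bar>a - x\<bar> + \<bar>b - a\<bar> \<le> d" "d \<le> \<bar>a - x\<bar> + \<bar>b - a\<bar> + \<bar>c - b\<bar>"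
      "b \<le> c \<longrightarrow> follow x [a, b, c] d = b + (d - \<bar>a - x\<bar> - \<bar>b - a\<bar>)"
      "c \<le> b \<longrightarrow> follow x [a, b, c] d = b - (d - \<bar>a - x\<bar> - \<bar>b - a\<bar>)"
  | (waiting) "\<bar>a - x\<bar> + \<bar>b - a\<bar> + \<bar>c - b\<bar> \<le> d" "follow x [a, b, c] d = c"
proof -
  have leg: "(u \<le> w \<longrightarrow> u + sgn (w - u) * r = u + r) \<and> (w \<le> u \<longrightarrow> u + sgn (w - u) * r = u - r)"
    if "0 \<le> r" "r \<le> \<bar>w - u\<bar>" for u w r :: real
    using that by (auto simp: sgn_if)
  consider "d \<le> \<bar>a - x\<bar>"
    | "\<bar>a - x\<bar> < d" "d - \<bar>a - x\<bar> \<le> \<bar>b - a\<bar>"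
    | "\<bar>a - x\<bar> < d" "\<bar>b - a\<bar> < d - \<bar>a - x\<bar>" "d - \<bar>a - x\<bar> - \<bar>b - a\<bar> \<le> \<bar>c - b\<bar>"
    | "\<bar>a - x\<bar> < d" "\<bar>b - a\<bar> < d - \<bar>a - x\<bar>" "\<bar>c - b\<bar> < d - \<bar>a - x\<bar> - \<bar>b - a\<bar>"
    by linarith
  then show thesis
  proof cases
    case 1
    then have "follow x [a, b, c] d = x + sgn (a - x) * d" by simp
    then show thesis using leg[of d a x] 1 assms first by presburger
  next
    case 2
    then have "follow x [a, b, c] d = a + sgn (b - a) * (d - \<bar>a - x\<bar>)" by simp
    then show thesis using leg[of "d - \<bar>a - x\<bar>" b a] 2 second by force
  next
    case 3
    then have "follow x [a, b, c] d = b + sgn (c - b) * (d - \<bar>a - x\<bar> - \<bar>b - a\<bar>)" by simp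
    then show thesis using leg[of "d - \<bar>a - x\<bar> - \<bar>b - a\<bar>" c b] 3 third by force
  next
    case 4
    then have "follow x [a, b, c] d = c" by simp
    then show thesis using 4 waiting by linarith
  qed
qed

lemma trajectory_replan:
  assumes "trajectory X" "0 \<le> t0"
  shows "trajectory (replan s I X t0)"
proof -
  let ?Y = "replan s I X t0"
  have X: "\<bar>X t - X u\<bar> \<le> \<bar>t - u\<bar>" if "0 \<le> t" "0 \<le> u" for t u
    using assms(1) that lipschitz_onD[of 1 "{0..}" X t u] by (auto simp: trajectory_def dist_real_def)
  have *: "\<bar>?Y t - ?Y u\<bar> \<le> t - u" if "0 \<le> u" "u \<le> t" for t u
  proof -
    consider "t \<le> t0" | "u \<le> t0" "t0 < t" | "t0 < u" using that by linarith
    then show ?thesis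
    proof cases
      case 2
      have "\<bar>?Y t - X t0\<bar> \<le> t - t0"
        using 2 follow_dist_start[of "t - t0" "X t0"] by (simp add: replan_def)
      moreover have "\<bar>X t0 - X u\<bar> \<le> t0 - u" using X[of t0 u] 2 that assms(2) by simp
      ultimately show ?thesis using 2 by (simp add: replan_def)
    next
      case 3
      then show ?thesis
        using follow_dist_le[of "u - t0" "t - t0" "X t0" "plan s I X t0"] that by (simp add: replan_def)
    qed (use X[of t u] that in \<open>auto simp: replan_def\<close>)
  qed
  have "?Y 0 = 0" using assms by (simp add: replan_def trajectory_def)
  moreover have "1-lipschitz_on {0..} ?Y"
  proof (rule lipschitz_onI)
    fix t u :: real assume "t \<in> {0..}" "u \<in> {0..}"
    then show "dist (?Y t) (?Y u) \<le> 1 * dist t u"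
      using *[of u t] *[of t u] by (cases "u \<le> t") (auto simp: dist_real_def)
  qed simp
  ultimately show ?thesis by (simp add: trajectory_def)
qed

declare follow.simps [simp del]

section \<open>The first unreleased prediction\<close>

lemma find_append: "find P (xs @ ys) = (case find P xs of None \<Rightarrow> find P ys | Some x \<Rightarrow> Some x)"
  by (induction xs) auto

lemma find_sorted_minimal:
  assumes "find P xs = Some i" "sorted (map k xs)" "j \<in> set xs" "P j"
  shows "k i \<le> k j"
  using assms by (induction xs) (auto split: if_splits)

lemma find_sort_key_Some:
  assumes "find P (sort_key k xs) = Some i"
  shows "i \<in> set xs" "P i" "j \<in> set xs \<Longrightarrow> P j \<Longrightarrow> k i \<le> k j"
proof -
  have "i \<in> set (sort_key k xs)" "P i"
    using assms by (auto simp: find_Some_iff simp del: set_sort)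
  then show "i \<in> set xs" "P i" by auto
  show "k i \<le> k j" if "j \<in> set xs" "P j"
    using find_sorted_minimal[OF assms, of k j] that by simp
qed

lemma find_sort_key_None: "find P (sort_key k xs) = None \<longleftrightarrow> (\<forall>x\<in>set xs. \<not> P x)"
  by (auto simp: find_None_iff)

text \<open>Positive predictions come first in the order, by decreasing size, so a negative result
  means that no unreleased prediction is positive. The default 0 of an exhausted search and an
  unreleased prediction at the origin share the case \<open>zero\<close>.\<close>

lemma next_pred_cases:
  obtains (pos) i where "i < num I" "t < rel I i" "next_pred True I t = prd I i" "0 < prd I i"
      "\<And>j. j < num I \<Longrightarrow> t < rel I j \<Longrightarrow> prd I j \<le> prd I i"
  | (neg) i where "i < num I" "t < rel I i" "next_pred True I t = prd I i" "prd I i < 0"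
      "\<And>j. j < num I \<Longrightarrow> t < rel I j \<Longrightarrow> prd I i \<le> prd I j \<and> prd I j \<le> 0"
  | (zero) "next_pred True I t = 0" "\<And>j. j < num I \<Longrightarrow> t < rel I j \<Longrightarrow> prd I j = 0"
proof -
  let ?P = "\<lambda>i. t < rel I i"
  let ?k = "\<lambda>i. - \<bar>prd I i\<bar>"
  let ?pos = "sort_key ?k (filter (\<lambda>i. on_side True (prd I i)) [0..<num I])"
  let ?neg = "sort_key ?k (filter (\<lambda>i. on_side False (prd I i)) [0..<num I])"
  let ?zero = "filter (\<lambda>i. prd I i = 0) [0..<num I]"
  have np: "next_pred True I t =
      (case find ?P (?pos @ ?neg @ ?zero) of None \<Rightarrow> 0 | Some i \<Rightarrow> prd I i)"
    by (simp add: next_pred_def farfirst_order_def)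
  show thesis
  proof (cases "find ?P ?pos")
    case (Some i)
    note f = find_sort_key_Some[OF Some]
    show thesis
    proof (rule pos)
      show "next_pred True I t = prd I i" by (simp add: np find_append Some)
      show "prd I j \<le> prd I i" if "j < num I" "t < rel I j" for j
        using f(1) f(3)[of j] that by (cases "0 < prd I j") (auto simp: on_side_def)
    qed (use f in \<open>auto simp: on_side_def\<close>)
  next
    case None
    then have le: "prd I j \<le> 0" if "j < num I" "t < rel I j" for j
      using that by (auto simp: find_sort_key_None on_side_def not_less)
    show thesis
    proof (cases "find ?P ?neg")
      case (Some i)
      note f = find_sort_key_Some[OF Some]
      show thesis
      proof (rule neg)
        show "next_pred True I t = prd I i" by (simp add: np find_append None Some)
        show "prd I i \<le> prd I j \<and> prd I j \<le> 0" if "j < num I" "t < rel I j" for j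
          using f(1) f(3)[of j] le[OF that] that
          by (cases "prd I j < 0") (auto simp: on_side_def)
      qed (use f in \<open>auto simp: on_side_def\<close>)
    next
      case None': None
      show thesis
      proof (rule zero)
        show "next_pred True I t = 0"
          by (auto simp: np find_append None None' find_Some_iff split: option.splits dest!: nth_mem)
        show "prd I j = 0" if "j < num I" "t < rel I j" for j
          using None' le[OF that] that by (auto simp: find_sort_key_None on_side_def not_less)
      qed
    qed
  qed
qed

section \<open>The invariant\<close>

text \<open>\<open>T\<close> is the completion time of an arbitrary competing trajectory, \<open>e\<close> the largest absolute
  deviation of a prediction, and \<open>L\<close>, \<open>R\<close> are the extreme positions. The assumption
  \<open>far_side\<close> holds when the far side is the positive one.\<close>

locale tour_bounds =
  fixes T e L R :: real
  assumes L_nonpos: "L \<le> 0" and R_nonneg: "0 \<le> R" and e_nonneg: "0 \<le> e"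
    and tour_length: "2 * R - 2 * L \<le> T" and far_side: "- L \<le> R + 2 * e"
begin

definition B :: real where
  "B = max (2 * R + 2 * e) (T + e)"

lemma B_ge: "2 * R + 2 * e \<le> B" "T + e \<le> B"
  by (auto simp: B_def)

text \<open>In the branch \<open>T + e\<close>, \<open>far_side\<close> replaces one of the two
  copies of \<open>- L\<close> by \<open>R + 2 * e\<close>, and \<open>R - L\<close> is at most
  \<open>T / 2\<close>. The other branch follows from \<open>tour_length\<close> and the signs of
  the parameters.\<close>

lemma B_le: "B - 2 * L \<le> 3 / 2 * T + 3 * e"
  using L_nonpos e_nonneg tour_length far_side R_nonneg by (auto simp: B_def)

text \<open>The arguments are the time \<open>t\<close>, the agent's position \<open>x\<close>, the positions \<open>S\<close> of the released
  unserved requests and the first unreleased prediction \<open>p\<close>. If nothing further were released,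
  the agent would finish the positive side at time \<open>t + 2 * z - x\<close> with
  \<open>z = Max (insert x S)\<close>. The disjunct \<open>t \<le> x\<close> says that it has moved straight
  outward so far; once it turns or waits, it never again is closer to the origin than \<open>p\<close>.\<close>

definition first_sweep :: "real \<Rightarrow> real \<Rightarrow> real set \<Rightarrow> real \<Rightarrow> bool" where
  "first_sweep t x S p \<longleftrightarrow> 0 \<le> x \<and> x \<le> R + e \<and> (t \<le> x \<or> p \<le> x) \<and> t + x \<le> B \<and>
     (\<forall>z\<in>S. t + 2 * z - x \<le> B)"

text \<open>Here \<open>tc\<close> is the time at which the agent crossed the origin. Positive positions in \<open>S\<close> were
  released after that time, hence \<open>tc + z \<le> T\<close>, and belong to nonpositive predictions, hence
  \<open>z \<le> e\<close>.\<close>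

definition second_sweep :: "real \<Rightarrow> real \<Rightarrow> real set \<Rightarrow> real \<Rightarrow> bool" where
  "second_sweep t x S p \<longleftrightarrow> x < 0 \<and> p \<le> 0 \<and> L - e \<le> x \<and> (\<forall>z\<in>S. z \<le> e) \<and>
     (\<exists>tc\<le>B. tc \<le> t \<and> (\<forall>z\<in>S. 0 < z \<longrightarrow> tc + z \<le> T) \<and>
        (t + x \<le> tc \<or> x \<le> p \<and> (\<forall>z\<in>S. z < x \<longrightarrow> t - 2 * z + x \<le> T + e)))"

text \<open>After the second sweep only requests predicted at the origin can remain.\<close>

definition near_origin :: "real \<Rightarrow> real set \<Rightarrow> real \<Rightarrow> bool" where
  "near_origin x S p \<longleftrightarrow> p = 0 \<and> \<bar>x\<bar> \<le> e \<and> L \<le> x \<and> x \<le> R \<and> (\<forall>z\<in>S. \<bar>z\<bar> \<le> e)"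

definition sweep_inv :: "real \<Rightarrow> real \<Rightarrow> real set \<Rightarrow> real \<Rightarrow> bool" where
  "sweep_inv t x S p \<longleftrightarrow> first_sweep t x S p \<or> second_sweep t x S p \<or> near_origin x S p"

text \<open>At a release time the agent stays at \<open>x\<close>, \<open>N\<close> holds the new
  positions and the next prediction advances from \<open>p\<close> to \<open>p'\<close>. Two facts
  control a new position: any tour still has to return from it, and it is within \<open>e\<close> of
  a prediction not preceding \<open>p\<close> in the order.\<close>

lemma sweep_inv_release:
  assumes "sweep_inv t x S p"
    and "\<And>z. z \<in> N \<Longrightarrow> L \<le> z \<and> z \<le> R \<and> t + \<bar>z\<bar> \<le> T \<and> z \<le> max p 0 + e \<and> (p \<le> 0 \<longrightarrow> p - e \<le> z)"
    and "S' \<subseteq> S \<union> N"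
    and "0 < p \<Longrightarrow> p' \<le> p" "p \<le> 0 \<Longrightarrow> p \<le> p' \<and> p' \<le> 0"
  shows "sweep_inv t x S' p'"
proof -
  consider "first_sweep t x S p" | "second_sweep t x S p" | "near_origin x S p"
    using assms(1) by (auto simp: sweep_inv_def)
  then show ?thesis
  proof cases
    case 1
    have "t + 2 * z - x \<le> B" if "z \<in> S'" for z
    proof (cases "z \<in> S")
      case True
      then show ?thesis using 1 by (auto simp: first_sweep_def)
    next
      case False
      then have "z \<in> N" using that assms(3) by auto
      from assms(2)[OF this] have z: "z \<le> R" "t + z \<le> T" "z \<le> max p 0 + e" by auto
      have x: "0 \<le> x" "t \<le> x \<or> max p 0 \<le> x" using 1 by (auto simp: first_sweep_def)
      from x(2) show ?thesis
      proof
        assume "t \<le> x"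
        then show ?thesis using z(1) B_ge(1) e_nonneg by linarith
      next
        \<comment> \<open>Here \<open>z \<le> x + e\<close>, so \<open>t + 2 * z - x\<close>, which
          is \<open>t + z\<close> plus \<open>z - x\<close>, is at most
          \<open>T + e\<close>.\<close>
        assume "max p 0 \<le> x"
        then show ?thesis using z(2,3) B_ge by linarith
      qed
    qed
    then have "first_sweep t x S' p'"
      using 1 assms(4,5) unfolding first_sweep_def by (cases "0 < p") auto
    then show ?thesis by (simp add: sweep_inv_def)
  next
    case 2
    then obtain tc where p: "x < 0" "p \<le> 0" "L - e \<le> x" "\<forall>z\<in>S. z \<le> e" and tc: "tc \<le> B" "tc \<le> t"
      "\<forall>z\<in>S. 0 < z \<longrightarrow> tc + z \<le> T"
      "t + x \<le> tc \<or> x \<le> p \<and> (\<forall>z\<in>S. z < x \<longrightarrow> t - 2 * z + x \<le> T + e)"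
      unfolding second_sweep_def by blast
    have N: "z \<le> e \<and> (0 < z \<longrightarrow> tc + z \<le> T) \<and> (x \<le> p \<longrightarrow> z < x \<longrightarrow> t - 2 * z + x \<le> T + e)"
      if "z \<in> N" for z
    proof -
      have z: "t + \<bar>z\<bar> \<le> T" "z \<le> e" "p - e \<le> z" using assms(2)[OF that] p(2) by auto
      then have "0 < z \<longrightarrow> tc + z \<le> T" using tc(2) by linarith
      \<comment> \<open>The left side is the return time to the origin via \<open>z\<close>. It
        splits into \<open>t - z\<close>, at most \<open>T\<close> because \<open>z\<close> is
        negative, and \<open>x - z\<close>, at most \<open>e\<close> because
        \<open>x \<le> p \<le> z + e\<close>.\<close>
      moreover have "x \<le> p \<longrightarrow> z < x \<longrightarrow> t - 2 * z + x \<le> T + e" using z p(1) by linarith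
      ultimately show ?thesis using z by blast
    qed
    have p': "x \<le> p \<longrightarrow> x \<le> p'" "p' \<le> 0" using assms(5) p by auto
    have S': "\<forall>z\<in>S'. z \<le> e" "\<forall>z\<in>S'. 0 < z \<longrightarrow> tc + z \<le> T"
      "x \<le> p \<and> (\<forall>z\<in>S. z < x \<longrightarrow> t - 2 * z + x \<le> T + e) \<longrightarrow>
        x \<le> p' \<and> (\<forall>z\<in>S'. z < x \<longrightarrow> t - 2 * z + x \<le> T + e)"
      using N p(4) tc(3) p' assms(3) by blast+
    then have "second_sweep t x S' p'"
      unfolding second_sweep_def using p tc p' by blast
    then show ?thesis by (simp add: sweep_inv_def)
  next
    case 3
    then have "p = 0" by (simp add: near_origin_def)
    then have "\<bar>z\<bar> \<le> e" if "z \<in> N" for z using assms(2)[OF that] by auto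
    then have "near_origin x S' p'"
      using 3 \<open>p = 0\<close> assms(3,5) unfolding near_origin_def by auto
    then show ?thesis by (simp add: sweep_inv_def)
  qed
qed

end

section \<open>Movement between two releases\<close>

lemma ext_cases:
  assumes "finite S"
  shows "ext True (S \<union> {x}) \<in> S \<union> {x} \<and> x \<le> ext True (S \<union> {x}) \<and> (\<forall>z\<in>S. z \<le> ext True (S \<union> {x}))"
    and "ext False (S \<union> {x}) \<in> S \<union> {x} \<and> ext False (S \<union> {x}) \<le> x \<and> (\<forall>z\<in>S. ext False (S \<union> {x}) \<le> z)"
  using assms Max_in[of "S \<union> {x}"] Min_in[of "S \<union> {x}"] by (auto simp: ext_def)

text \<open>This is \<open>plan\<close> for a positive far side with both side conventions resolved:
  the origin counts as positive for the agent, and \<open>p = 0\<close> selects the side opposite to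
  the agent. It depends only on numbers and a set, so the movement can be analysed without an
  instance.\<close>

definition itinerary :: "real \<Rightarrow> real set \<Rightarrow> real \<Rightarrow> real list" where
  "itinerary x S p = [ext (0 \<le> x) (S \<union> {x}), ext (0 < p \<or> p = 0 \<and> x < 0) (S \<union> {p}), p]"

context tour_bounds
begin

text \<open>Both turning points are maxima: \<open>a\<close> is \<open>x\<close> or a request, and
  \<open>b\<close> exceeds \<open>a\<close> only if \<open>b = p\<close>. The agent never falls back
  below \<open>p\<close> after turning, and a request left behind the turning points lies inward of
  the agent, where \<open>t + d + ?y \<le> B\<close> already covers it. The last assumption limits
  the waiting time at \<open>p\<close>.\<close>

lemma first_sweep_move_outward:
  assumes inv: "first_sweep t x S p" and p: "0 < p" "p \<le> R + e"
    and S: "finite S" "S \<subseteq> {L..R}"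
    and S': "S' \<subseteq> S" "S' \<inter> follow x (itinerary x S p) ` {0..d} = {}"
    and d: "0 \<le> d" "t + d + p \<le> T + e"
  shows "first_sweep (t + d) (follow x (itinerary x S p) d) S' p"
proof -
  obtain a b where it: "itinerary x S p = [a, b, p]"
    and a: "a = ext True (S \<union> {x})" and b: "b = ext True (S \<union> {p})"
    using inv p by (simp add: itinerary_def first_sweep_def)
  note a = ext_cases(1)[OF S(1), of x, folded a]
  note b = ext_cases(1)[OF S(1), of p, folded b]
  have x: "0 \<le> x" "x \<le> R + e" "t \<le> x \<or> p \<le> x" "t + x \<le> B" "\<forall>z\<in>S. t + 2 * z - x \<le> B"
    using inv by (auto simp: first_sweep_def)
  have aB: "t + 2 * a - x \<le> B" using a x by (auto simp del: ex_simps)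
  have A: "x \<le> a" "a = x \<or> a \<le> b \<and> a \<le> R" using a b S(2) by auto
  have B: "p \<le> b" "b = p \<or> b \<le> a \<and> b \<le> R" using a b S(2) by auto
  let ?y = "follow x [a, b, p] d"
  have nv: "z \<notin> follow x [a, b, p] ` {0..d}" if "z \<in> S'" for z using that S'(2) unfolding it by blast
  note side = not_visited_same_side[OF nv d(1)]
  have le: "z \<le> a \<and> z \<le> b \<and> t + 2 * z - x \<le> B" if "z \<in> S'" for z using that S'(1) a b x by auto
  \<comment> \<open>If \<open>b\<close> is a request, then \<open>b \<le> a\<close> and
    \<open>aB\<close> applies. If \<open>b = p\<close>, either \<open>p \<le> x\<close> and
    \<open>t + x \<le> B\<close> applies, or \<open>t \<le> x\<close> and the value is at most
    \<open>2 * p \<le> 2 * R + 2 * e\<close>.\<close>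
  have B2: "t + b + (b - x) \<le> B" using B_ge x A B aB e_nonneg p(2) by (smt (verit))
  have "0 \<le> ?y \<and> ?y \<le> R + e \<and> (t + d \<le> ?y \<or> p \<le> ?y) \<and> t + d + ?y \<le> B \<and>
     (\<forall>z\<in>S'. t + d + 2 * z - ?y \<le> B)"
  using d(1) proof (cases rule: follow_legs[where x = x and a = a and b = b and c = p])
    case first
    then have y: "?y = x + d" "?y \<le> a" using A by auto
    then have "\<forall>z\<in>S'. t + d + 2 * z - ?y \<le> B" using le by force
    moreover have "0 \<le> ?y \<and> ?y \<le> R + e \<and> (t + d \<le> ?y \<or> p \<le> ?y) \<and> t + d + ?y \<le> B"
      using y A aB x d e_nonneg by (smt (verit))
    ultimately show ?thesis by simp
  next
    case second
    have "t + d + 2 * z - ?y \<le> B" if "z \<in> S'" for z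
      using second A B aB x d e_nonneg le[OF that] side(1,2)[OF that] p by (smt (verit))
    moreover have "0 \<le> ?y \<and> ?y \<le> R + e \<and> (t + d \<le> ?y \<or> p \<le> ?y) \<and> t + d + ?y \<le> B"
      using second A B aB B2 x d p e_nonneg by (smt (verit))
    ultimately show ?thesis by simp
  next
    case third
    have y: "?y = b - (d - \<bar>a - x\<bar> - \<bar>b - a\<bar>)" "p \<le> ?y" "?y \<le> b" using third B by auto
    have "t + d + ?y \<le> B" using y(1) A B aB B2 by (smt (verit))
    moreover have "0 \<le> ?y \<and> ?y \<le> R + e" using y p B e_nonneg by (smt (verit))
    moreover have "t + d + 2 * z - ?y \<le> B" if "z \<in> S'" for z
      using third(1) y(3) le[OF that] side(3)[OF that] \<open>t + d + ?y \<le> B\<close> by (smt (verit))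
    ultimately show ?thesis using y(2) by simp
  next
    case waiting
    have "t + d + ?y \<le> B" using waiting(2) d(2) B_ge by linarith
    moreover have "t + d + 2 * z - ?y \<le> B" if "z \<in> S'" for z
      using waiting B(1) le[OF that] side(3)[OF that] calculation by (smt (verit))
    ultimately show ?thesis using waiting(2) p by simp
  qed
  then show ?thesis unfolding it first_sweep_def .
qed

end

lemma follow_hull:
  assumes "0 \<le> d" "lo \<le> x" "x \<le> hi" "lo \<le> a" "a \<le> hi" "lo \<le> b" "b \<le> hi" "lo \<le> c" "c \<le> hi"
  shows "lo \<le> follow x [a, b, c] d \<and> follow x [a, b, c] d \<le> hi"
  using assms(1) by (cases rule: follow_legs[where x = x and a = a and b = b and c = c])
    (use assms in \<open>smt (verit)\<close>)+

context tour_bounds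
begin

text \<open>The agent goes out to \<open>a\<close>, turns, and crosses the origin at time
  \<open>t + 2 * a - x \<le> B\<close>, having served all positive requests. That time becomes the
  \<open>tc\<close> of \<open>second_sweep\<close>. An agent resting at the origin with
  \<open>p = 0\<close> satisfies \<open>near_origin\<close> instead.\<close>

lemma first_sweep_move_inward:
  assumes inv: "first_sweep t x S p" and p: "p \<le> 0" "L - e \<le> p"
    and S: "finite S" "S \<subseteq> {L..R}"
    and S': "S' \<subseteq> S" "S' \<inter> follow x (itinerary x S p) ` {0..d} = {}"
    and d: "0 \<le> d"
  shows "sweep_inv (t + d) (follow x (itinerary x S p) d) S' p"
proof -
  obtain a b where it: "itinerary x S p = [a, b, p]"
    and a: "a = ext True (S \<union> {x})" and b: "b = ext False (S \<union> {p})"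
    using inv p by (simp add: itinerary_def first_sweep_def)
  note a = ext_cases(1)[OF S(1), of x, folded a]
  note b = ext_cases(2)[OF S(1), of p, folded b]
  have x: "0 \<le> x" "x \<le> R + e" "t + x \<le> B" "\<forall>z\<in>S. t + 2 * z - x \<le> B"
    using inv by (auto simp: first_sweep_def)
  have aB: "t + 2 * a - x \<le> B" using a x by auto
  have A: "x \<le> a" "a \<le> R + e" using a S(2) x(2) e_nonneg by auto
  have b: "b \<le> p" "L - e \<le> b" "\<forall>z\<in>S. b \<le> z" using b S(2) p e_nonneg by auto
  let ?y = "follow x [a, b, p] d"
  have nv: "z \<notin> follow x [a, b, p] ` {0..d}" if "z \<in> S'" for z using that S'(2) unfolding it by blast
  note side = not_visited_same_side[OF nv d(1)]
  have le: "b \<le> z \<and> z \<le> a \<and> t + 2 * z - x \<le> B" if "z \<in> S'" for z using that S'(1) a b x by auto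
  have "sweep_inv (t + d) ?y S' p"
  using d(1) proof (cases rule: follow_legs[where x = x and a = a and b = b and c = p])
    case first
    then have y: "?y = x + d" "?y \<le> a" using A by auto
    then have "t + d + 2 * z - ?y \<le> B" if "z \<in> S'" for z using le[OF that] by linarith
    then have "first_sweep (t + d) ?y S' p"
      using y A aB x p d unfolding first_sweep_def by auto
    then show ?thesis unfolding sweep_inv_def by blast
  next
    case second
    have "b \<le> a" using b(1) p A(1) x(1) by linarith
    then have y: "?y = a - (d - \<bar>a - x\<bar>)" using second(4) by blast
    have y_le: "b \<le> ?y" "?y \<le> a" using second(1,2) y \<open>b \<le> a\<close> by linarith+
    \<comment> \<open>Time plus position is constant on a leftward leg, so this is the crossing time
      of the origin.\<close>
    have t_y: "t + d + ?y = t + 2 * a - x" using y A by linarith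
    have le_y: "z < ?y" if "z \<in> S'" for z
      using second(1) y_le A le[OF that] side(2)[OF that] by (smt (verit))
    show ?thesis
    proof (cases "0 \<le> ?y")
      case True
      have "t + d + 2 * z - ?y \<le> B" if "z \<in> S'" for z using le_y[OF that] t_y aB by linarith
      then have "first_sweep (t + d) ?y S' p"
        using True y_le A aB t_y p unfolding first_sweep_def by auto
      then show ?thesis unfolding sweep_inv_def by blast
    next
      case False
      have "z < 0" if "z \<in> S'" for z using le_y[OF that] False by linarith
      then have "\<forall>z\<in>S'. z \<le> e \<and> (0 < z \<longrightarrow> t + 2 * a - x + z \<le> T)" using e_nonneg by fastforce
      moreover have "t + 2 * a - x \<le> t + d" "L - e \<le> ?y" using t_y False y_le b by linarith+
      ultimately have "second_sweep (t + d) ?y S' p"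
        using False p aB t_y unfolding second_sweep_def
        by (intro conjI exI[of _ "t + 2 * a - x"]) auto
      then show ?thesis unfolding sweep_inv_def by blast
    qed
  next
    case third
    have y: "b \<le> ?y" "?y \<le> p" using third b by auto
    \<comment> \<open>Once \<open>b\<close> is reached the whole interval from \<open>b\<close> to
      \<open>a\<close> has been visited, and it contains \<open>S\<close>.\<close>
    have "S' = {}" using side(3)[OF _ third(1)] le y p A x by (smt (verit) all_not_in_conv)
    moreover have "t + 2 * a - x \<le> t + d" using third(1) A b p x by (smt (verit))
    ultimately show ?thesis using y b p aB L_nonpos R_nonneg e_nonneg
      unfolding sweep_inv_def second_sweep_def near_origin_def
      by (cases "?y = 0") auto
  next
    case waiting
    have "S' = {}" using side(3)[of _] waiting le p A b x by (smt (verit) all_not_in_conv)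
    moreover have "t + 2 * a - x \<le> t + d" using waiting(1) A b p x by (smt (verit))
    ultimately show ?thesis using waiting(2) b p aB L_nonpos R_nonneg e_nonneg
      unfolding sweep_inv_def second_sweep_def near_origin_def
      by (cases "?y = 0") auto
  qed
  then show ?thesis by (simp only: it)
qed

text \<open>Time plus position is constant while the agent moves left, which preserves
  \<open>t + x \<le> tc\<close> and also the return times \<open>t - 2 * z + x\<close>. Once it
  moves right it is at or left of \<open>p\<close>, and every request left of it has been served, so
  the condition on \<open>z\<close> is vacuous. The witness \<open>tc\<close> never changes.\<close>

lemma second_sweep_move_outward:
  assumes inv: "second_sweep t x S p" and p: "p < 0" "L - e \<le> p"
    and S: "finite S" "S \<subseteq> {L..R}"
    and S': "S' \<subseteq> S" "S' \<inter> follow x (itinerary x S p) ` {0..d} = {}"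
    and d: "0 \<le> d"
  shows "second_sweep (t + d) (follow x (itinerary x S p) d) S' p"
proof -
  obtain a b where it: "itinerary x S p = [a, b, p]"
    and a: "a = ext False (S \<union> {x})" and b: "b = ext False (S \<union> {p})"
    using inv p by (simp add: itinerary_def second_sweep_def)
  note a = ext_cases(2)[OF S(1), of x, folded a]
  note b = ext_cases(2)[OF S(1), of p, folded b]
  obtain tc where x: "x < 0" "L - e \<le> x" "\<forall>z\<in>S. z \<le> e" and tc: "tc \<le> B" "tc \<le> t"
    "\<forall>z\<in>S. 0 < z \<longrightarrow> tc + z \<le> T"
    "t + x \<le> tc \<or> x \<le> p \<and> (\<forall>z\<in>S. z < x \<longrightarrow> t - 2 * z + x \<le> T + e)"
    using inv unfolding second_sweep_def by blast
  have A: "a \<le> x" "L - e \<le> a" "a = x \<or> a \<in> S \<and> b \<le> a" using a b S(2) x(2) e_nonneg by auto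
  have b: "b \<le> p" "L - e \<le> b" "b = p \<or> a \<le> b" "\<forall>z\<in>S. b \<le> z" using a b S(2) p e_nonneg by auto
  let ?y = "follow x [a, b, p] d"
  have nv: "z \<notin> follow x [a, b, p] ` {0..d}" if "z \<in> S'" for z using that S'(2) unfolding it by blast
  note side = not_visited_same_side[OF nv d(1)]
  have le: "a \<le> z \<and> b \<le> z" if "z \<in> S'" for z using that S'(1) a b x by auto
  have S'x: "\<forall>z\<in>S'. z \<le> e \<and> (0 < z \<longrightarrow> tc + z \<le> T)" using S'(1) x(3) tc(3) by auto
  have goal: "second_sweep (t + d) ?y S' p"
    if "?y < 0" "L - e \<le> ?y"
      "t + d + ?y \<le> tc \<or> ?y \<le> p \<and> (\<forall>z\<in>S'. z < ?y \<longrightarrow> t + d - 2 * z + ?y \<le> T + e)"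
    unfolding second_sweep_def using that S'x p tc d
    by (intro conjI exI[of _ tc]) auto
  have "second_sweep (t + d) ?y S' p"
  using d(1) proof (cases rule: follow_legs[where x = x and a = a and b = b and c = p])
    case first
    then have y: "?y = x - d" "a \<le> ?y" using A by auto
    show ?thesis
    proof (rule goal)
      show "t + d + ?y \<le> tc \<or> ?y \<le> p \<and> (\<forall>z\<in>S'. z < ?y \<longrightarrow> t + d - 2 * z + ?y \<le> T + e)"
        using tc(4)
      proof
        assume *: "x \<le> p \<and> (\<forall>z\<in>S. z < x \<longrightarrow> t - 2 * z + x \<le> T + e)"
        have "t + d - 2 * z + ?y \<le> T + e" if "z \<in> S'" "z < ?y" for z
        proof -
          have "z < x" using that(2) y(1) d by linarith
          then have "t - 2 * z + x \<le> T + e" using * that(1) S'(1) by blast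
          then show ?thesis using y(1) by linarith
        qed
        then show ?thesis using * y(1) d by auto
      qed (use y in linarith)
    qed (use y x A d in linarith)+
  next
    case second
    \<comment> \<open>If \<open>b\<close> is left of \<open>a\<close> the agent is still moving
      left; otherwise it moves right towards \<open>b \<le> p\<close>.\<close>
    have y: "?y < 0 \<and> L - e \<le> ?y \<and> (t + d + ?y = t + x \<or> ?y \<le> p)"
    proof (cases "a \<le> b")
      case True
      then have "?y = a + (d - \<bar>a - x\<bar>)" using second(3) by blast
      then show ?thesis using second(1,2) True A b p by linarith
    next
      case False
      then have "?y = a - (d - \<bar>a - x\<bar>)" using second(4) by simp
      then show ?thesis using second(1,2) False A b x by linarith
    qed
    have le_y: "?y < z" if "z \<in> S'" for z
      using second(1) side(2)[OF that] le[OF that] by linarith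
    show ?thesis
    proof (rule goal)
      have "\<forall>z\<in>S'. z < ?y \<longrightarrow> t + d - 2 * z + ?y \<le> T + e" using le_y by fastforce
      moreover have "t + d + ?y \<le> tc \<or> ?y \<le> p" using y tc(4) second(1) A(1) by linarith
      ultimately show "t + d + ?y \<le> tc \<or> ?y \<le> p \<and> (\<forall>z\<in>S'. z < ?y \<longrightarrow> t + d - 2 * z + ?y \<le> T + e)"
        by blast
    qed (use y in blast)+
  next
    case third
    have y: "b \<le> ?y" "?y \<le> p" using third b by auto
    have le_y: "?y < z" if "z \<in> S'" for z
      using third(1) side(3)[OF that] le[OF that] y by (smt (verit))
    then have "\<not> z < ?y" if "z \<in> S'" for z using that by fastforce
    then show ?thesis using y b p by (intro goal) (linarith | blast)+
  next
    case waiting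
    have le_y: "?y < z" if "z \<in> S'" for z
      using waiting side(3)[OF that] le[OF that] b by (smt (verit))
    then have "\<not> z < ?y" if "z \<in> S'" for z using that by fastforce
    then show ?thesis using waiting(2) eq_refl[OF waiting(2)] p by (intro goal) (linarith | blast)+
  qed
  then show ?thesis by (simp only: it)
qed

text \<open>With \<open>p = 0\<close> the second destination is on the positive side, at most
  \<open>e\<close> and \<open>R\<close> away. All negative requests of \<open>S\<close> have been
  served when the agent returns to the origin, so from there on \<open>near_origin\<close>
  holds.\<close>

lemma second_sweep_move_inward:
  assumes inv: "second_sweep t x S 0"
    and S: "finite S" "S \<subseteq> {L..R}"
    and S': "S' \<subseteq> S" "S' \<inter> follow x (itinerary x S 0) ` {0..d} = {}"
    and d: "0 \<le> d"
  shows "sweep_inv (t + d) (follow x (itinerary x S 0) d) S' 0"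
proof -
  obtain a b where it: "itinerary x S 0 = [a, b, 0]"
    and a: "a = ext False (S \<union> {x})" and b: "b = ext True (S \<union> {0})"
    using inv by (simp add: itinerary_def second_sweep_def)
  note a = ext_cases(2)[OF S(1), of x, folded a]
  note b = ext_cases(1)[OF S(1), of 0, folded b]
  obtain tc where x: "x < 0" "L - e \<le> x" "\<forall>z\<in>S. z \<le> e" and tc: "tc \<le> B" "tc \<le> t"
    "\<forall>z\<in>S. 0 < z \<longrightarrow> tc + z \<le> T"
    "t + x \<le> tc \<or> x \<le> 0 \<and> (\<forall>z\<in>S. z < x \<longrightarrow> t - 2 * z + x \<le> T + e)"
    using inv unfolding second_sweep_def by blast
  have A: "a \<le> x" "L - e \<le> a" using a S(2) x(2) e_nonneg by auto
  have b: "0 \<le> b" "b \<le> R" "b \<le> e" using b S(2) x(3) e_nonneg R_nonneg by auto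
  let ?y = "follow x [a, b, 0] d"
  have nv: "z \<notin> follow x [a, b, 0] ` {0..d}" if "z \<in> S'" for z using that S'(2) unfolding it by blast
  note side = not_visited_same_side[OF nv d(1)]
  have le: "a \<le> z \<and> z \<le> e" if "z \<in> S'" for z using that S'(1) a x by auto
  have S'x: "\<forall>z\<in>S'. z \<le> e \<and> (0 < z \<longrightarrow> tc + z \<le> T)" using S'(1) x(3) tc(3) by auto
  have goal2: "sweep_inv (t + d) ?y S' 0"
    if "?y < 0" "L - e \<le> ?y"
      "t + d + ?y \<le> tc \<or> (\<forall>z\<in>S'. z < ?y \<longrightarrow> t + d - 2 * z + ?y \<le> T + e)"
  proof -
    have "second_sweep (t + d) ?y S' 0"
      unfolding second_sweep_def using that S'x tc(1,2) d
      by (intro conjI exI[of _ tc]) auto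
    then show ?thesis unfolding sweep_inv_def by blast
  qed
  have goal: "sweep_inv (t + d) ?y S' 0"
    if y: "?y \<le> b" "a \<le> ?y" and le_y: "\<And>z. z \<in> S' \<Longrightarrow> z < a \<or> ?y < z"
  proof (cases "?y < 0")
    case True
    have "\<forall>z\<in>S'. z < ?y \<longrightarrow> t + d - 2 * z + ?y \<le> T + e" using le_y le by fastforce
    then show ?thesis using goal2 True y(2) A by linarith
  next
    case False
    have "\<bar>z\<bar> \<le> e" if "z \<in> S'" for z using le_y[OF that] le[OF that] False by linarith
    then have "near_origin ?y S' 0"
      unfolding near_origin_def using False y b L_nonpos by auto
    then show ?thesis unfolding sweep_inv_def by blast
  qed
  have "sweep_inv (t + d) ?y S' 0"
  using d(1) proof (cases rule: follow_legs[where x = x and a = a and b = b and c = 0])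
    case first
    then have y: "?y = x - d" "a \<le> ?y" using A by auto
    show ?thesis
    proof (rule goal2)
      show "t + d + ?y \<le> tc \<or> (\<forall>z\<in>S'. z < ?y \<longrightarrow> t + d - 2 * z + ?y \<le> T + e)"
        using tc(4)
      proof
        assume *: "x \<le> 0 \<and> (\<forall>z\<in>S. z < x \<longrightarrow> t - 2 * z + x \<le> T + e)"
        have "t + d - 2 * z + ?y \<le> T + e" if "z \<in> S'" "z < ?y" for z
        proof -
          have "z < x" using that(2) y(1) d by linarith
          then have "t - 2 * z + x \<le> T + e" using * that(1) S'(1) by blast
          then show ?thesis using y(1) by linarith
        qed
        then show ?thesis by auto
      qed (use y in linarith)
    qed (use y x A d in linarith)+
  next
    case second
    have y: "?y \<le> b" "a \<le> ?y" using second A b x by (smt (verit))+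
    show ?thesis using second y side(2) by (intro goal) blast+
  next
    case third
    have y: "?y \<le> b" "0 \<le> ?y" using third b by auto
    show ?thesis using third(1) y A x side(3) by (intro goal) (linarith | blast)+
  next
    case waiting
    have "\<bar>a - x\<bar> + \<bar>b - a\<bar> \<le> d" using waiting by linarith
    then show ?thesis using waiting(2) b A x side(3) by (intro goal) (linarith | blast)+
  qed
  then show ?thesis by (simp only: it)
qed

text \<open>The start and all destinations lie between \<open>max L (- e)\<close> and
  \<open>min R e\<close>, hence so does the path.\<close>

lemma near_origin_move:
  assumes inv: "near_origin x S p" and S: "finite S" "S \<subseteq> {L..R}" and "S' \<subseteq> S" and d: "0 \<le> d"
  shows "near_origin (follow x (itinerary x S p) d) S' p"
proof -
  have p: "p = 0" using inv by (simp add: near_origin_def)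
  obtain a b where it: "itinerary x S p = [a, b, 0]" and a: "a \<in> S \<union> {x}" and b: "b \<in> S \<union> {0}"
  proof (rule that)
    show "itinerary x S p = [ext (0 \<le> x) (S \<union> {x}), ext (x < 0) (S \<union> {0}), 0]"
      using p by (simp add: itinerary_def)
    show "ext (0 \<le> x) (S \<union> {x}) \<in> S \<union> {x}"
      using ext_cases[OF S(1), of x] by (cases "0 \<le> x") auto
    show "ext (x < 0) (S \<union> {0}) \<in> S \<union> {0}"
      using ext_cases[OF S(1), of 0] by (cases "x < 0") auto
  qed
  have S_hull: "max L (- e) \<le> z \<and> z \<le> min R e" if "z \<in> S" for z
    using that inv S(2) unfolding near_origin_def by fastforce
  have "max L (- e) \<le> z \<and> z \<le> min R e" if "z \<in> {x, 0}" for z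
    using that inv L_nonpos R_nonneg e_nonneg unfolding near_origin_def by auto
  then have "max L (- e) \<le> follow x [a, b, 0] d \<and> follow x [a, b, 0] d \<le> min R e"
    using a b S_hull by (intro follow_hull[OF d]) blast+
  then show ?thesis
    using inv assms(4) unfolding it near_origin_def by auto
qed

text \<open>Here \<open>S'\<close> is what may remain of \<open>S\<close> after moving for time
  \<open>d\<close> without any release. While a positive \<open>p\<close> awaits release, its
  request must later be visited by every tour, which justifies the last assumption.\<close>

lemma sweep_inv_move:
  assumes inv: "sweep_inv t x S p" and p: "L - e \<le> p" "p \<le> R + e"
    and S: "finite S" "S \<subseteq> {L..R}"
    and S': "S' \<subseteq> S" "S' \<inter> follow x (itinerary x S p) ` {0..d} = {}"
    and d: "0 \<le> d" "0 < p \<Longrightarrow> t + d + p \<le> T + e"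
  shows "sweep_inv (t + d) (follow x (itinerary x S p) d) S' p"
proof -
  consider "first_sweep t x S p" "0 < p" | "first_sweep t x S p" "p \<le> 0"
    | "second_sweep t x S p" "p < 0" | "second_sweep t x S p" "p = 0" | "near_origin x S p"
    using inv unfolding sweep_inv_def by (metis linorder_cases not_le_imp_less order_le_less second_sweep_def)
  then show ?thesis
  proof cases
    case 1
    then show ?thesis
      using first_sweep_move_outward[OF 1 p(2) S S' d(1)] d(2) unfolding sweep_inv_def by blast
  next
    case 2
    then show ?thesis using first_sweep_move_inward[OF 2 p(1) S S' d(1)] by simp
  next
    case 3
    then show ?thesis using second_sweep_move_outward[OF 3 p(1) S S' d(1)] unfolding sweep_inv_def by blast
  next
    case 4
    then show ?thesis using second_sweep_move_inward[OF _ S _ _ d(1)] S' by blast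
  next
    case 5
    then show ?thesis using near_origin_move[OF 5 S S'(1) d(1)] unfolding sweep_inv_def by blast
  qed
qed
text \<open>Everything is released, so the plan runs to its end at the origin. Its cost
  \<open>d\<close> is the sum of its three legs, and each disjunct of the invariant bounds
  \<open>t + d\<close> separately.\<close>

lemma sweep_inv_finish:
  assumes inv: "sweep_inv t x S 0" and S: "finite S" "S \<subseteq> {L..R}" and t: "t \<le> T" "\<bar>x\<bar> \<le> t"
  shows "\<exists>d\<ge>0. follow x (itinerary x S 0) d = 0 \<and> S \<subseteq> follow x (itinerary x S 0) ` {0..d} \<and>
    t + d \<le> 3 / 2 * T + 3 * e \<and> t + d \<le> 3 * T"
proof (cases "0 \<le> x")
  case True
  define a where "a = ext True (S \<union> {x})"
  define b where "b = ext False (S \<union> {0})"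
  have it: "itinerary x S 0 = [a, b, 0]" using True by (simp add: itinerary_def a_def b_def)
  have a: "x \<le> a" "\<forall>z\<in>S. z \<le> a" "a = x \<or> a \<in> S \<and> a \<le> R"
    using ext_cases(1)[OF S(1), of x, folded a_def] S(2) by auto
  have b: "b \<le> 0" "\<forall>z\<in>S. b \<le> z" "b = 0 \<or> b \<in> S" "L \<le> b"
    using ext_cases(2)[OF S(1), of 0, folded b_def] S(2) L_nonpos by auto
  define d where "d = (a - x) + (a - b) - b"
  have d: "0 \<le> d" "\<bar>a - x\<bar> + \<bar>b - a\<bar> \<le> d" "\<bar>a - x\<bar> + \<bar>b - a\<bar> + \<bar>0 - b\<bar> \<le> d"
    using a(1) b(1) True unfolding d_def by linarith+
  have "follow x [a, b, 0] d = 0"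
    using d(1) by (cases rule: follow_legs[where x = x and a = a and b = b and c = 0])
      (use d a b True in linarith)+
  moreover have "S \<subseteq> follow x [a, b, 0] ` {0..d}"
  proof
    fix z assume "z \<in> S"
    then show "z \<in> follow x [a, b, 0] ` {0..d}"
      using not_visited_same_side(3)[OF _ d(1,2)] a(2) b(2) by force
  qed
  moreover have "t + d \<le> 3 / 2 * T + 3 * e"
    using inv unfolding sweep_inv_def
  proof (elim disjE)
    assume "first_sweep t x S 0"
    then have "t + 2 * a - x \<le> B" using a(3) unfolding first_sweep_def by auto
    then show ?thesis using B_le b(4) unfolding d_def by linarith
  next
    assume "second_sweep t x S 0"
    then show ?thesis using True by (simp add: second_sweep_def)
  next
    assume "near_origin x S 0"
    then have "a \<le> e" "a \<le> R" "- b \<le> e"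
      using a(3) b(3) e_nonneg unfolding near_origin_def by auto
    \<comment> \<open>Of the two copies of \<open>a - b\<close>, one is at most
      \<open>R - L \<le> T / 2\<close> and the other at most \<open>2 * e\<close>.\<close>
    then show ?thesis using t(1) True b(4) tour_length e_nonneg unfolding d_def by linarith
  qed
  moreover have "t + d \<le> 3 * T"
    using a(3)
  proof
    assume "a = x"
    then show ?thesis using t b(4) tour_length R_nonneg unfolding d_def by linarith
  next
    assume "a \<in> S \<and> a \<le> R"
    then show ?thesis using t b(4) tour_length True L_nonpos R_nonneg unfolding d_def by linarith
  qed
  ultimately show ?thesis unfolding it using d(1) by blast
next
  case False
  define a where "a = ext False (S \<union> {x})"
  define b where "b = ext True (S \<union> {0})"
  have it: "itinerary x S 0 = [a, b, 0]" using False by (simp add: itinerary_def a_def b_def)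
  have a: "a \<le> x" "\<forall>z\<in>S. a \<le> z" "a = x \<or> a \<in> S \<and> L \<le> a"
    using ext_cases(2)[OF S(1), of x, folded a_def] S(2) by auto
  have b: "0 \<le> b" "\<forall>z\<in>S. z \<le> b" "b = 0 \<or> b \<in> S" "b \<le> R"
    using ext_cases(1)[OF S(1), of 0, folded b_def] S(2) R_nonneg by auto
  define d where "d = (x - a) + (b - a) + b"
  have d: "0 \<le> d" "\<bar>a - x\<bar> + \<bar>b - a\<bar> \<le> d" "\<bar>a - x\<bar> + \<bar>b - a\<bar> + \<bar>0 - b\<bar> \<le> d"
    using a(1) b(1) False unfolding d_def by linarith+
  have "follow x [a, b, 0] d = 0"
    using d(1) by (cases rule: follow_legs[where x = x and a = a and b = b and c = 0])
      (use d a b False in linarith)+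
  moreover have "S \<subseteq> follow x [a, b, 0] ` {0..d}"
  proof
    fix z assume "z \<in> S"
    then show "z \<in> follow x [a, b, 0] ` {0..d}"
      using not_visited_same_side(3)[OF _ d(1,2)] a(2) b(2) by force
  qed
  moreover have "t + d \<le> 3 / 2 * T + 3 * e"
    using inv unfolding sweep_inv_def
  proof (elim disjE)
    assume "first_sweep t x S 0"
    then show ?thesis using False by (simp add: first_sweep_def)
  next
    assume "second_sweep t x S 0"
    then obtain tc where x: "L - e \<le> x" "\<forall>z\<in>S. z \<le> e" and tc: "tc \<le> B" "tc \<le> t"
      "\<forall>z\<in>S. 0 < z \<longrightarrow> tc + z \<le> T"
      "t + x \<le> tc \<or> (\<forall>z\<in>S. z < x \<longrightarrow> t - 2 * z + x \<le> T + e)"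
      unfolding second_sweep_def by blast
    have b_le: "b \<le> e" "b = 0 \<or> tc + b \<le> T" using b(1,3) x(2) tc(3) e_nonneg by auto
    \<comment> \<open>If \<open>a\<close> is not \<open>x\<close>, it is a request left of
      \<open>x\<close>, so \<open>tc(4)\<close> gives either \<open>t + x \<le> tc\<close> or the
      return bound for \<open>a\<close>. A positive \<open>b\<close> is a request, and
      \<open>tc + b \<le> T\<close> then absorbs one of the two copies of \<open>b\<close>; the
      other is at most \<open>e\<close>.\<close>
    consider "a = x" | "L \<le> a" "t + x \<le> tc" "b = 0" | "L \<le> a" "t + x \<le> tc" "tc + b \<le> T"
      | "t - 2 * a + x \<le> T + e"
      using a(1,3) b_le(2) tc(4) by fastforce
    then show ?thesis
    proof cases
      case 1
      then show ?thesis using t x(1) b_le(1) b(4) tour_length L_nonpos R_nonneg e_nonneg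
        unfolding d_def by linarith
    next
      case 2
      then show ?thesis using tc(1) B_le unfolding d_def by linarith
    next
      case 3
      then show ?thesis using b_le(1) tour_length far_side unfolding d_def by linarith
    next
      case 4
      then show ?thesis using b_le(1) tour_length L_nonpos R_nonneg unfolding d_def by linarith
    qed
  next
    assume "near_origin x S 0"
    then have "- a \<le> e" "L \<le> a" "b \<le> e"
      using a(3) b(3) e_nonneg unfolding near_origin_def by auto
    then show ?thesis using t(1) False b(4) tour_length e_nonneg unfolding d_def by linarith
  qed
  moreover have "t + d \<le> 3 * T"
    using a(3)
  proof
    assume "a = x"
    then show ?thesis using t b(4) tour_length L_nonpos unfolding d_def by linarith
  next
    assume "a \<in> S \<and> L \<le> a"
    then show ?thesis using t b(4) tour_length False L_nonpos R_nonneg unfolding d_def by linarith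
  qed
  ultimately show ?thesis unfolding it using d(1) by blast
qed

end

section \<open>Running FARFIRST\<close>

definition open_requests :: "line_instance \<Rightarrow> (real \<Rightarrow> real) \<Rightarrow> real \<Rightarrow> real set" where
  "open_requests I X t = loc I ` {i. i < num I \<and> rel I i \<le> t \<and> \<not> served I X i t}"

lemma trajectory_farfirst:
  assumes "valid_instance I"
  shows "trajectory (farfirst s I)"
proof -
  have "trajectory (foldl (replan s I) X ts)" if "trajectory X" "\<And>t. t \<in> set ts \<Longrightarrow> 0 \<le> t" for X ts
    using that by (induction ts arbitrary: X) (auto intro: trajectory_replan)
  moreover have "trajectory (\<lambda>_. 0)" by (auto simp: trajectory_def intro: lipschitz_onI)
  moreover have "0 \<le> t" if "t \<in> set (sorted_list_of_set (insert 0 (rel I ` {..<num I})))" for t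
    using that assms unfolding valid_instance_def by (subst (asm) set_sorted_list_of_set) auto
  ultimately show ?thesis
    unfolding farfirst_def by blast
qed

lemma finite_open_requests: "finite (open_requests I X t)"
  by (simp add: open_requests_def)

lemma plan_eq_itinerary:
  "plan True I X t = itinerary (X t) (open_requests I X t) (next_pred True I t)"
proof -
  have "X t \<noteq> 0 \<Longrightarrow> (0 < X t) = (0 \<le> X t)" "X t \<noteq> 0 \<Longrightarrow> (\<not> 0 < X t) = (X t < 0)" by auto
  then show ?thesis by (auto simp: plan_def itinerary_def open_requests_def Let_def)
qed

lemma replan_after:
  "0 \<le> d \<Longrightarrow> replan True I X t (t + d) =
    follow (X t) (itinerary (X t) (open_requests I X t) (next_pred True I t)) d"
  by (simp add: replan_def plan_eq_itinerary)

text \<open>The request is already released at \<open>t\<close>, so every visit to its position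
  during the new movement would serve it, as would any valid visit before \<open>t\<close>, where
  both movements agree.\<close>

lemma unserved_replan:
  assumes "i < num I" "rel I i \<le> t" "0 \<le> d" "\<not> served I (replan True I X t) i (t + d)"
  shows "loc I i \<in> open_requests I X t -
    follow (X t) (itinerary (X t) (open_requests I X t) (next_pred True I t)) ` {0..d}"
proof -
  have never: "replan True I X t v \<noteq> loc I i" if "rel I i \<le> v" "v \<le> t + d" for v
    using assms(4) that by (auto simp: served_def)
  then have "X v \<noteq> loc I i" if "rel I i \<le> v" "v \<le> t" for v
    using that assms(3) by (force simp: replan_def)
  then have "\<not> served I X i t" by (auto simp: served_def)
  moreover have "follow (X t) (itinerary (X t) (open_requests I X t) (next_pred True I t)) d' \<noteq> loc I i"
    if "d' \<in> {0..d}" for d'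
    using never[of "t + d'"] that assms(2) by (simp add: replan_after)
  ultimately show ?thesis using assms(1,2) by (force simp: open_requests_def)
qed

locale far_positive_run = tour_bounds T e L R for T e L R :: real +
  fixes I :: line_instance
  assumes loc_range: "i < num I \<Longrightarrow> loc I i \<in> {L..R}"
    and pred_close: "i < num I \<Longrightarrow> \<bar>loc I i - prd I i\<bar> \<le> e"
    and rel_nonneg: "i < num I \<Longrightarrow> 0 \<le> rel I i"
    and rel_return: "i < num I \<Longrightarrow> rel I i + \<bar>loc I i\<bar> \<le> T"
begin

lemma open_requests_range: "open_requests I X t \<subseteq> {L..R}"
  using loc_range by (auto simp: open_requests_def)

lemma next_pred_range: "L - e \<le> next_pred True I t \<and> next_pred True I t \<le> R + e"
proof (cases rule: next_pred_cases[of I t])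
  case (pos i)
  then show ?thesis using pred_close[of i] loc_range[of i] by auto
next
  case (neg i)
  then show ?thesis using pred_close[of i] loc_range[of i] by auto
next
  case zero
  then show ?thesis using L_nonpos R_nonneg e_nonneg by auto
qed

lemma next_pred_bounds:
  assumes "i < num I" "t < rel I i"
  shows "prd I i \<le> max (next_pred True I t) 0"
    and "next_pred True I t \<le> 0 \<Longrightarrow> next_pred True I t \<le> prd I i \<and> prd I i \<le> 0"
  using assms by (cases rule: next_pred_cases[of I t]; force)+

text \<open>Requests unreleased at \<open>u\<close> were unreleased at \<open>t\<close>, so the
  search can only advance in the order. These are the monotonicity assumptions of
  \<open>sweep_inv_release\<close>.\<close>

lemma next_pred_later:
  assumes "t \<le> u"
  shows "0 < next_pred True I t \<Longrightarrow> next_pred True I u \<le> next_pred True I t"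
    and "next_pred True I t \<le> 0 \<Longrightarrow> next_pred True I t \<le> next_pred True I u \<and> next_pred True I u \<le> 0"
proof -
  note bounds = next_pred_bounds[where t = t]
  show "next_pred True I u \<le> next_pred True I t" if "0 < next_pred True I t"
    by (cases rule: next_pred_cases[of I u]) (use bounds assms that in fastforce)+
  show "next_pred True I t \<le> next_pred True I u \<and> next_pred True I u \<le> 0"
    if "next_pred True I t \<le> 0"
    by (cases rule: next_pred_cases[of I u]) (use bounds assms that in fastforce)+
qed

text \<open>Passing to the next release time \<open>u\<close> splits into a movement without
  releases, during which \<open>p\<close> stays fixed, and the releases at \<open>u\<close>
  itself.\<close>

lemma sweep_inv_replan:
  assumes inv: "sweep_inv t (X t) (open_requests I X t) (next_pred True I t)"
    and "t < u" and next_release: "\<And>i. i < num I \<Longrightarrow> t < rel I i \<Longrightarrow> u \<le> rel I i"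
  defines "Y \<equiv> replan True I X t"
  shows "sweep_inv u (Y u) (open_requests I Y u) (next_pred True I u)"
proof -
  let ?S = "open_requests I X t" and ?p = "next_pred True I t"
  let ?f = "follow (X t) (itinerary (X t) ?S ?p)"
  define d where "d = u - t"
  have d: "0 \<le> d" "u = t + d" using assms(2) by (auto simp: d_def)
  have Y_u: "Y u = ?f d" unfolding Y_def d(2) by (rule replan_after[OF d(1)])
  \<comment> \<open>The request \<open>i\<close> predicted at \<open>?p\<close> is released no
    earlier than \<open>u\<close>, and its position is at least \<open>?p - e\<close>, so
    \<open>rel_return\<close> gives the bound.\<close>
  have waits: "u + ?p \<le> T + e" if "0 < ?p"
  proof (cases rule: next_pred_cases[of I t])
    case (pos i)
    then show ?thesis using next_release[of i] rel_return[of i] pred_close[of i] by auto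
  qed (use that in auto)
  have range: "L - e \<le> ?p" "?p \<le> R + e" using next_pred_range by auto
  have "sweep_inv (t + d) (?f d) (?S - ?f ` {0..d}) ?p"
  proof (rule sweep_inv_move[OF inv range finite_open_requests open_requests_range])
    show "t + d + ?p \<le> T + e" if "0 < ?p" using waits[OF that] d(2) by simp
    show "?S - ?f ` {0..d} \<subseteq> ?S" by (rule Diff_subset)
    show "(?S - ?f ` {0..d}) \<inter> ?f ` {0..d} = {}" by (rule Diff_disjoint[THEN trans[OF Int_commute]])
  qed (fact d(1))
  then have moved: "sweep_inv u (Y u) (?S - ?f ` {0..d}) ?p"
    by (simp only: Y_u d(2)[symmetric])
  define N where "N = loc I ` {i. i < num I \<and> rel I i = u}"
  show ?thesis
  proof (rule sweep_inv_release[OF moved])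
    show "open_requests I Y u \<subseteq> ?S - ?f ` {0..d} \<union> N"
    proof
      fix z assume "z \<in> open_requests I Y u"
      then obtain i where i: "i < num I" "rel I i \<le> u" "\<not> served I Y i u" "z = loc I i"
        by (auto simp: open_requests_def)
      show "z \<in> ?S - ?f ` {0..d} \<union> N"
      proof (cases "rel I i \<le> t")
        case True
        have "\<not> served I (replan True I X t) i (t + d)"
          using i(3) unfolding Y_def d(2)[symmetric] .
        from unserved_replan[OF i(1) True d(1) this] show ?thesis unfolding i(4) by (rule UnI1)
      next
        case False
        then have "rel I i = u" using next_release[OF i(1)] i(2) by simp
        then show ?thesis using i by (auto simp: N_def)
      qed
    qed
  next
    fix z assume "z \<in> N"
    then obtain i where i: "i < num I" "rel I i = u" "z = loc I i" by (auto simp: N_def)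
    then have "t < rel I i" using assms(2) by simp
    then show "L \<le> z \<and> z \<le> R \<and> u + \<bar>z\<bar> \<le> T \<and> z \<le> max ?p 0 + e \<and> (?p \<le> 0 \<longrightarrow> ?p - e \<le> z)"
      using next_pred_bounds[OF i(1), of t] pred_close[OF i(1)] loc_range[OF i(1)]
        rel_return[OF i(1)] unfolding i(2,3) atLeastAtMost_iff by argo
  qed (use next_pred_later[of t u] assms(2) in simp_all)
qed

text \<open>Induction over the remaining release times, with the \<open>replan\<close> at
  \<open>t\<close> still pending. When none remain, the next prediction is the default 0 and
  \<open>sweep_inv_finish\<close> applies.\<close>

lemma completion_of_run:
  assumes "trajectory X" "sorted_wrt (<) (t # ts)" "0 \<le> t" "t \<le> T"
    and "sweep_inv t (X t) (open_requests I X t) (next_pred True I t)"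
    and "\<And>i. i < num I \<Longrightarrow> t < rel I i \<Longrightarrow> rel I i \<in> set ts" "\<And>u. u \<in> set ts \<Longrightarrow> u \<le> T"
  shows "\<exists>F. complete I (foldl (replan True I) X (t # ts)) F \<and> F \<le> 3 / 2 * T + 3 * e \<and> F \<le> 3 * T"
  using assms
proof (induction ts arbitrary: X t)
  case Nil
  let ?Y = "replan True I X t"
  let ?S = "open_requests I X t"
  have all: "rel I i \<le> t" if "i < num I" for i using Nil.prems(6)[OF that] by force
  then have p: "next_pred True I t = 0"
    by (cases rule: next_pred_cases[of I t]) force+
  have "\<bar>X t\<bar> \<le> t"
    using Nil.prems(1,3) lipschitz_onD[of 1 "{0..}" X t 0] by (auto simp: trajectory_def dist_real_def)
  then obtain d where d: "0 \<le> d" "follow (X t) (itinerary (X t) ?S 0) d = 0"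
    "?S \<subseteq> follow (X t) (itinerary (X t) ?S 0) ` {0..d}" "t + d \<le> 3 / 2 * T + 3 * e" "t + d \<le> 3 * T"
    using sweep_inv_finish[OF _ finite_open_requests open_requests_range Nil.prems(4)] Nil.prems(5)
    unfolding p by metis
  have "complete I ?Y (t + d)"
    unfolding complete_def
  proof (intro conjI allI impI)
    show "served I ?Y i (t + d)" if "i < num I" for i
      using unserved_replan[OF that all[OF that] d(1)] d(3) unfolding p by blast
    show "?Y (t + d) = 0" using replan_after[OF d(1)] d(2) p by simp
  qed (use d(1) Nil.prems(3) in auto)
  then show ?case using d by auto
next
  case (Cons u us)
  let ?Y = "replan True I X t"
  have "t < u" using Cons.prems(2) by simp
  have "u \<le> rel I i" if "i < num I" "t < rel I i" for i
    using Cons.prems(6)[OF that] Cons.prems(2) by auto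
  then have "sweep_inv u (?Y u) (open_requests I ?Y u) (next_pred True I u)"
    using sweep_inv_replan[where X = X, OF Cons.prems(5) \<open>t < u\<close>] by blast
  moreover have "rel I i \<in> set us" if "i < num I" "u < rel I i" for i
    using Cons.prems(6)[of i] that \<open>t < u\<close> by auto
  ultimately have "\<exists>F. complete I (foldl (replan True I) ?Y (u # us)) F \<and>
      F \<le> 3 / 2 * T + 3 * e \<and> F \<le> 3 * T"
    using Cons.prems \<open>t < u\<close> trajectory_replan[OF Cons.prems(1,3)] by (intro Cons.IH) auto
  then show ?case by simp
qed

lemma farfirst_completion:
  assumes "0 \<le> T"
  shows "\<exists>F. complete I (farfirst True I) F \<and> F \<le> 3 / 2 * T + 3 * e \<and> F \<le> 3 * T"
proof -
  let ?A = "insert 0 (rel I ` {..<num I})"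
  have fin: "finite ?A" by simp
  have min: "Min ?A = 0" using rel_nonneg by (intro Min_eqI) auto
  then have list: "sorted_list_of_set ?A = 0 # sorted_list_of_set (?A - {0})"
    using sorted_list_of_set_nonempty[OF fin] by simp
  have "trajectory (\<lambda>_. 0)" by (auto simp: trajectory_def intro: lipschitz_onI)
  \<comment> \<open>At time 0 the disjunct \<open>t \<le> x\<close> holds at the origin, and a
    request \<open>z \<le> R\<close> gives \<open>2 * z \<le> B\<close>.\<close>
  moreover have "sweep_inv 0 0 (open_requests I (\<lambda>_. 0) 0) (next_pred True I 0)"
    using open_requests_range[of "\<lambda>_. 0" 0] B_ge R_nonneg e_nonneg
    unfolding sweep_inv_def first_sweep_def by fastforce
  moreover have "sorted_wrt (<) (0 # sorted_list_of_set (?A - {0}))"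
    using strict_sorted_list_of_set[of ?A] unfolding list .
  ultimately show ?thesis
    unfolding farfirst_def list
  proof (intro completion_of_run)
    show "u \<le> T" if "u \<in> set (sorted_list_of_set (?A - {0}))" for u
      using that rel_return by fastforce
  qed (use assms in auto)
qed

end

section \<open>Reflection at the origin\<close>

definition mirror :: "line_instance \<Rightarrow> line_instance" where
  "mirror I = I\<lparr>loc := \<lambda>i. - loc I i, prd := \<lambda>i. - prd I i\<rparr>"

lemma mirror_simps [simp]:
  "num (mirror I) = num I" "loc (mirror I) i = - loc I i"
  "rel (mirror I) = rel I" "prd (mirror I) i = - prd I i"
  by (simp_all add: mirror_def)

lemma served_mirror [simp]: "served (mirror I) (\<lambda>t. - X t) i t = served I X i t"
  by (simp add: served_def)

lemma complete_mirror: "complete (mirror I) (\<lambda>t. - X t) T = complete I X T"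
  by (simp add: complete_def)

lemma trajectory_uminus: "trajectory X \<Longrightarrow> trajectory (\<lambda>t. - X t)"
  by (simp add: trajectory_def lipschitz_on_def)

lemma valid_mirror: "valid_instance I \<Longrightarrow> valid_instance (mirror I)"
  by (simp add: valid_instance_def)

lemma is_far_side_mirror:
  assumes "is_far_side I s"
  shows "is_far_side (mirror I) (\<not> s)"
proof -
  obtain i where i: "i < num I" "\<forall>j<num I. \<bar>prd I j\<bar> \<le> \<bar>prd I i\<bar>" "prd I i \<noteq> 0 \<longrightarrow> s = (0 < prd I i)"
    using assms unfolding is_far_side_def by blast
  have "prd I i \<noteq> 0 \<longrightarrow> (\<not> s) = (prd I i < 0)" using i(3) by linarith
  then show ?thesis unfolding is_far_side_def using i(1,2) by (intro exI[of _ i]) simp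
qed

text \<open>Reflection preserves absolute values and labels while exchanging the sides, so the order
  is the same list of labels.\<close>

lemma next_pred_mirror: "next_pred (\<not> s) (mirror I) t = - next_pred s I t"
proof -
  have "on_side (\<not> s) (- x) = on_side s x" "on_side s (- x) = on_side (\<not> s) x" for s x
    by (auto simp: on_side_def)
  then have "farfirst_order (\<not> s) (mirror I) = farfirst_order s I"
    by (simp add: farfirst_order_def)
  then show ?thesis by (simp add: next_pred_def split: option.split)
qed

lemma ext_uminus: "finite S \<Longrightarrow> S \<noteq> {} \<Longrightarrow> ext (\<not> s) (uminus ` S) = - ext s S"
  by (simp add: ext_def minus_Max_eq_Min minus_Min_eq_Max)

text \<open>The conventions at the origin are symmetric as well: \<open>posSide\<close> falls back
  to the far side, which is reflected too, and \<open>pSide\<close> to the opposite of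
  \<open>posSide\<close>.\<close>

lemma plan_mirror: "plan (\<not> s) (mirror I) (\<lambda>t. - X t) t = map uminus (plan s I X t)"
proof -
  define S where "S = loc I ` {i. i < num I \<and> rel I i \<le> t \<and> \<not> served I X i t}"
  have S': "loc (mirror I) ` {i. i < num (mirror I) \<and> rel (mirror I) i \<le> t \<and>
      \<not> served (mirror I) (\<lambda>t. - X t) i t} = uminus ` S"
    by (simp add: S_def image_image)
  have "finite S" by (simp add: S_def)
  then have ext_insert: "ext s' (insert y (uminus ` S)) = - ext s'' (insert x S)"
    if "s' = (\<not> s'')" "y = - x" for s' s'' x y
    using ext_uminus[of "insert x S" s''] that by simp
  show ?thesis
    unfolding plan_def Let_def S' S_def[symmetric] next_pred_mirror
    by (auto intro!: ext_insert)
qed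

lemma follow_uminus: "follow (- x) (map uminus ws) d = - follow x ws d"
proof (induction ws arbitrary: x d)
  case (Cons w ws)
  have "\<bar>- w + x\<bar> = \<bar>w - x\<bar>" "sgn (x - w) = - sgn (w - x)" by (auto simp: sgn_if)
  then show ?case using Cons.IH[of w] by (simp add: follow.simps)
qed (simp add: follow.simps)

lemma replan_mirror: "replan (\<not> s) (mirror I) (\<lambda>t. - X t) t0 = (\<lambda>t. - replan s I X t0 t)"
  by (simp add: replan_def plan_mirror follow_uminus fun_eq_iff)

lemma farfirst_mirror: "farfirst (\<not> s) (mirror I) = (\<lambda>t. - farfirst s I t)"
proof -
  have "foldl (replan (\<not> s) (mirror I)) (\<lambda>t. - X t) ts = (\<lambda>t. - foldl (replan s I) X ts t)" for X ts
    by (induction ts arbitrary: X) (simp_all add: replan_mirror)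
  from this[of "\<lambda>_. 0"] show ?thesis by (simp add: farfirst_def)
qed

section \<open>Competitiveness\<close>

definition max_deviation :: "line_instance \<Rightarrow> real" where
  "max_deviation I = Max ((\<lambda>i. \<bar>loc I i - prd I i\<bar>) ` {..<num I})"

definition leftmost :: "line_instance \<Rightarrow> real" where
  "leftmost I = Min (loc I ` {..<num I})"

definition rightmost :: "line_instance \<Rightarrow> real" where
  "rightmost I = Max (loc I ` {..<num I})"

lemma max_deviation_ge: "i < num I \<Longrightarrow> \<bar>loc I i - prd I i\<bar> \<le> max_deviation I"
  by (auto simp: max_deviation_def intro!: Max_ge)

lemma loc_bounds: "i < num I \<Longrightarrow> leftmost I \<le> loc I i \<and> loc I i \<le> rightmost I"
  by (auto simp: leftmost_def rightmost_def)

lemma extremes_attained: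
  assumes "valid_instance I"
  obtains i j where "i < num I" "loc I i = leftmost I" "j < num I" "loc I j = rightmost I"
proof -
  have "{..<num I} \<noteq> {}" using assms by (auto simp: valid_instance_def)
  then have "leftmost I \<in> loc I ` {..<num I}" "rightmost I \<in> loc I ` {..<num I}"
    unfolding leftmost_def rightmost_def by (intro Min_in Max_in; simp)+
  then show thesis using that by auto
qed

lemma origin_bounds:
  assumes "valid_instance I"
  shows "leftmost I \<le> 0" "0 \<le> rightmost I" "0 \<le> max_deviation I"
proof -
  obtain i where "i < num I" "loc I i = 0" using assms by (auto simp: valid_instance_def)
  then show "leftmost I \<le> 0" "0 \<le> rightmost I" "0 \<le> max_deviation I"
    using loc_bounds[of i I] max_deviation_ge[of i I] by auto
qed

section \<open>Lower bounds for offline tours\<close>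

lemma trajectory_dist: "trajectory X \<Longrightarrow> 0 \<le> t \<Longrightarrow> 0 \<le> u \<Longrightarrow> \<bar>X t - X u\<bar> \<le> \<bar>t - u\<bar>"
  using lipschitz_onD[of 1 "{0..}" X t u] by (auto simp: trajectory_def dist_real_def)

lemma complete_visit:
  assumes "valid_instance I" "complete I Y T" "i < num I"
  obtains v where "rel I i \<le> v" "0 \<le> v" "v \<le> T" "Y v = loc I i"
proof -
  have "0 \<le> rel I i" using assms(1,3) unfolding valid_instance_def by blast
  moreover obtain v where "rel I i \<le> v" "v \<le> T" "Y v = loc I i"
    using assms(2,3) unfolding complete_def served_def by blast
  ultimately show thesis using that[of v] by linarith
qed

lemma complete_ge_rel:
  assumes "valid_instance I" "trajectory Y" "complete I Y T" "i < num I"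
  shows "rel I i + \<bar>loc I i\<bar> \<le> T"
proof -
  obtain v where "rel I i \<le> v" "0 \<le> v" "v \<le> T" "Y v = loc I i"
    using complete_visit[OF assms(1,3,4)] .
  then show ?thesis using trajectory_dist[OF assms(2), of v T] assms(3) by (auto simp: complete_def)
qed

text \<open>A tour visits both extremes and starts and ends at the origin. The speed bounds between
  these four events cover both visiting orders.\<close>

lemma complete_ge_tour:
  assumes "valid_instance I" "trajectory Y" "complete I Y T"
  shows "2 * rightmost I - 2 * leftmost I \<le> T"
proof -
  obtain i j where ij: "i < num I" "loc I i = leftmost I" "j < num I" "loc I j = rightmost I"
    using extremes_attained[OF assms(1)] .
  obtain v where v: "0 \<le> v" "v \<le> T" "Y v = leftmost I"
    by (rule complete_visit[OF assms(1,3) ij(1)]) (simp only: ij(2))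
  obtain w where w: "0 \<le> w" "w \<le> T" "Y w = rightmost I"
    by (rule complete_visit[OF assms(1,3) ij(3)]) (simp only: ij(4))
  have Y: "Y 0 = 0" "Y T = 0" using assms(2,3) by (auto simp: trajectory_def complete_def)
  have T: "0 \<le> T" using v by linarith
  note dist = trajectory_dist[OF assms(2)]
  show ?thesis
    using dist[OF v(1) w(1)] dist[OF v(1) order_refl] dist[OF w(1) order_refl]
      dist[OF v(1) T] dist[OF w(1) T] v(1,2) w(1,2)
    unfolding Y v(3) w(3) by linarith
qed

text \<open>The furthest prediction \<open>i\<close> is nonnegative. Going from the leftmost request
  to its prediction costs one deviation, that prediction is no further out than \<open>i\<close>,
  and going from \<open>i\<close> to its request costs a second one.\<close>

lemma far_side_bound:
  assumes "valid_instance I" "is_far_side I True"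
  shows "- leftmost I \<le> rightmost I + 2 * max_deviation I"
proof -
  obtain j where j: "j < num I" "loc I j = leftmost I" using extremes_attained[OF assms(1)] .
  obtain i where i: "i < num I" "\<forall>j<num I. \<bar>prd I j\<bar> \<le> \<bar>prd I i\<bar>" "0 \<le> prd I i"
    using assms(2) unfolding is_far_side_def by (metis less_eq_real_def)
  have "\<bar>prd I j\<bar> \<le> prd I i" using i j(1) by force
  then show ?thesis
    using max_deviation_ge[OF i(1)] max_deviation_ge[OF j(1)] loc_bounds[OF i(1)] j(2) by linarith
qed

lemma farfirst_completion_positive:
  assumes "valid_instance I" "is_far_side I True" "trajectory Y" "complete I Y T"
  shows "\<exists>F. complete I (farfirst True I) F \<and>
    F \<le> 3 / 2 * T + 3 * max_deviation I \<and> F \<le> 3 * T"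
proof -
  interpret far_positive_run T "max_deviation I" "leftmost I" "rightmost I" I
    by unfold_locales
      (use assms origin_bounds complete_ge_tour far_side_bound complete_ge_rel max_deviation_ge
        loc_bounds in \<open>auto simp: valid_instance_def\<close>)
  show ?thesis using assms(4) by (intro farfirst_completion) (simp add: complete_def)
qed

lemma max_deviation_mirror: "max_deviation (mirror I) = max_deviation I"
  by (simp add: max_deviation_def abs_minus_commute)

text \<open>A negative far side reduces to the positive one, since reflection preserves completion
  times and deviations.\<close>

lemma farfirst_completion:
  assumes "valid_instance I" "is_far_side I s" "trajectory Y" "complete I Y T"
  shows "\<exists>F. complete I (farfirst s I) F \<and> F \<le> 3 / 2 * T + 3 * max_deviation I \<and> F \<le> 3 * T"
proof (cases s)
  case True
  then have s: "s = True" by simp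
  have "is_far_side I True" using assms(2) unfolding s .
  from farfirst_completion_positive[OF assms(1) this assms(3,4)] show ?thesis unfolding s .
next
  case False
  then have s: "s = False" by simp
  have A: "farfirst True (mirror I) = (\<lambda>t. - farfirst s I t)"
    using farfirst_mirror[of False I] unfolding s not_False_eq_True .
  have "is_far_side (mirror I) True"
    using is_far_side_mirror[OF assms(2)] unfolding s not_False_eq_True .
  moreover have "complete (mirror I) (\<lambda>t. - Y t) T" unfolding complete_mirror by (fact assms(4))
  ultimately have "\<exists>F. complete (mirror I) (farfirst True (mirror I)) F \<and>
      F \<le> 3 / 2 * T + 3 * max_deviation (mirror I) \<and> F \<le> 3 * T"
    by (rule farfirst_completion_positive[OF valid_mirror[OF assms(1)] _ trajectory_uminus[OF assms(3)]])
  then show ?thesis unfolding A complete_mirror max_deviation_mirror .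
qed

section \<open>From completion times to the competitive ratio\<close>

lemma makespan_le: "complete I X F \<Longrightarrow> makespan I X \<le> ereal F"
  unfolding makespan_def by (rule Inf_lower) simp

text \<open>Turns the extended-real ratio into a positive real \<open>c\<close>. When all requests
  are at the origin, the error is 0 or infinite, and the ratio is \<open>3 / 2\<close> or 3
  respectively; otherwise the error is finite and \<open>T \<ge> 2 * M\<close> converts the
  deviation term.\<close>

lemma ratio_cases:
  assumes "valid_instance I"
  obtains c where "min (3 * (1 + pred_error I) / 2) 3 = ereal c" "0 < c"
    "\<And>T F. 2 * rightmost I - 2 * leftmost I \<le> T \<Longrightarrow>
      F \<le> 3 / 2 * T + 3 * max_deviation I \<Longrightarrow> F \<le> 3 * T \<Longrightarrow> F \<le> c * T"
proof -
  define M where "M = rightmost I - leftmost I"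
  let ?e = "max_deviation I"
  have M: "0 \<le> M" "0 \<le> ?e" using origin_bounds[OF assms] by (auto simp: M_def)
  have err: "pred_error I = ereal ?e / ereal M"
    using origin_bounds[OF assms]
    by (simp add: pred_error_def M_def max_deviation_def leftmost_def rightmost_def)
  have three: "(3 :: ereal) = ereal 3" "(2 :: ereal) = ereal 2" "(1 :: ereal) = ereal 1" by simp_all
  consider "0 < M" | "M = 0" "?e = 0" | "M = 0" "0 < ?e" using M by linarith
  then show thesis
  proof cases
    case 1
    let ?c = "min (3 * (1 + ?e / M) / 2) 3"
    show thesis
    proof (rule that)
      show "min (3 * (1 + pred_error I) / 2) 3 = ereal ?c"
        using 1 unfolding err three by simp
      show "0 < ?c" using 1 M by (simp add: add_pos_nonneg)
      fix T F assume *: "2 * rightmost I - 2 * leftmost I \<le> T" "F \<le> 3 / 2 * T + 3 * ?e" "F \<le> 3 * T"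
      have "?e * (2 * M) \<le> ?e * T" using *(1) M by (intro mult_left_mono) (auto simp: M_def)
      then have "2 * ?e \<le> ?e / M * T" using 1 by (simp add: field_simps)
      moreover have "F \<le> 3 / 2 * T + 3 / 2 * r" if "2 * ?e \<le> r" for r
        using that *(2) by linarith
      moreover have "3 / 2 * T + 3 / 2 * (?e / M * T) = 3 * (1 + ?e / M) / 2 * T"
        by (simp add: algebra_simps)
      ultimately have "F \<le> 3 * (1 + ?e / M) / 2 * T" by metis
      then show "F \<le> ?c * T" using *(3) by (simp add: min_def)
    qed
  next
    case 2
    show thesis
    proof (rule that)
      show "min (3 * (1 + pred_error I) / 2) 3 = ereal (3 / 2)"
        unfolding err three 2 by simp
    qed (use 2 in auto)
  next
    case 3
    show thesis
    proof (rule that)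
      show "min (3 * (1 + pred_error I) / 2) 3 = ereal 3"
        unfolding err three 3(1) using 3(2) by simp
    qed auto
  qed
qed

theorem theorem1:
  fixes farSide :: "line_instance \<Rightarrow> bool"
  assumes "\<And>I. valid_instance I \<Longrightarrow> is_far_side I (farSide I)"
  shows "competitive (\<lambda>I. farfirst (farSide I) I) (\<lambda>I. min (3 * (1 + pred_error I) / 2) 3)"
  unfolding competitive_def
proof (intro allI impI conjI)
  fix I assume valid: "valid_instance I"
  let ?A = "farfirst (farSide I) I"
  show "trajectory ?A" by (rule trajectory_farfirst[OF valid])
  obtain c where c: "min (3 * (1 + pred_error I) / 2) 3 = ereal c" "0 < c"
    "\<And>T F. 2 * rightmost I - 2 * leftmost I \<le> T \<Longrightarrow>
      F \<le> 3 / 2 * T + 3 * max_deviation I \<Longrightarrow> F \<le> 3 * T \<Longrightarrow> F \<le> c * T"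
    using ratio_cases[OF valid] by blast
  \<comment> \<open>Dividing by the positive real \<open>c\<close> leaves a lower bound on each
    offline completion time, which passes to the infima in \<open>makespan\<close> and
    \<open>opt\<close>.\<close>
  have "makespan I ?A / ereal c \<le> ereal T" if Y: "trajectory Y" "complete I Y T" for Y T
  proof -
    obtain F where F: "complete I ?A F" "F \<le> 3 / 2 * T + 3 * max_deviation I" "F \<le> 3 * T"
      using farfirst_completion[OF valid assms[OF valid] Y] by auto
    have "makespan I ?A \<le> ereal (c * T)"
      using makespan_le[OF F(1)] c(3)[OF complete_ge_tour[OF valid Y] F(2,3)]
      by (meson ereal_less_eq(3) order_trans)
    then show ?thesis using c(2) by (simp add: ereal_divide_le_pos)
  qed
  then have "makespan I ?A / ereal c \<le> opt I"
    unfolding opt_def by (auto simp: makespan_def[of I Y for Y] intro!: INF_greatest)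
  then show "makespan I ?A \<le> min (3 * (1 + pred_error I) / 2) 3 * opt I"
    unfolding c(1) using c(2) by (simp add: ereal_divide_le_pos)
qed

end
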